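(* Let $\mathcal{P}_T>0$ and suppose $N_A=1$ (SIMOME scenario). Then among all input distributions $p_{(u,x)}$ with $\mathbb{E}[|x|^2]\le\mathcal{P}_T$, the ergodic positive secrecy rate $\mathrm{EPSR}$ is maximized by the one for which $u\equiv x$ and $x$ is a (circularly symmetric) complex Gaussian random variable with variance $\mathcal{P}_T$; that is, $$\max_{\substack{p_{(u,x)}\\ \mathbb{E}[|x|^2]\le\mathcal{P}_T}}\mathrm{EPSR}=\mathbb{E}_{\mathbf{h},\mathbf{g}}\left[\left(\log\left(\frac{1+\mathcal{P}_T\lVert\mathbf{h}\rVert^2}{1+\mathcal{P}_T\lVert\mathbf{g}\rVert^2}\right)\right)^+\right].$$
   Context: Channel model (SIMOME: single transmit antenna). Let $N_B,N_E\ge1$ be integers. A message $u$, a random variable in an arbitrary set $\mathcal{U}$, is encoded into a complex random variable $x\in\mathbb{C}$; the joint law $p_{(u,x)}$ is the input distribution (the set $\mathcal U$, the law of $u$ and the conditional law of $x$ given $u$ are all free). The legitimate receiver observes $\mathbf{y}=\mathbf{h}x+\mathbf{w}_B\in\mathbb{C}^{N_B}$ and the eavesdropper observes $\mathbf{z}=\mathbf{g}x+\mathbf{w}_E\in\mathbb{C}^{N_E}$, where $\mathbf{h}\in\mathbb{C}^{N_B}$ (legitimate channel) and $\mathbf{g}\in\mathbb{C}^{N_E}$ (eavesdropper channel) are random vectors, with arbitrary given distributions, independent of $(u,x)$, and $\mathbf{w}_B,\mathbf{w}_E$ are circularly symmetric complex Gaussian noise vectors with identity covariance, independent of each other and of everything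 else. $\lVert\cdot\rVert$ is the Euclidean norm; $\log$ is base 2; $I(\cdot;\cdot)$ is Shannon mutual information in bits; $(t)^+=\max(0,t)$. Instantaneous quantities: $I(u;\mathbf{y})$ and $I(u;\mathbf{z})$ denote the mutual informations for the instantaneous channel states, i.e. $I(u;\mathbf{y}\mid\mathbf{h}=\mathbf{h}_0)$ evaluated at $\mathbf{h}_0=\mathbf{h}$ and $I(u;\mathbf{z}\mid\mathbf{g}=\mathbf{g}_0)$ evaluated at $\mathbf{g}_0=\mathbf{g}$; they are thus random variables, functions of $(\mathbf{h},\mathbf{g})$. The ergodic positive secrecy rate is $\mathrm{EPSR}=\mathbb{E}_{\mathbf{h},\mathbf{g}}\big[(I(u;\mathbf{y})-I(u;\mathbf{z}))^+\big]$. The notation $u\equiv x$ means that $u$ is identified with $x$ (no precoding). *)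

theory Defs
  imports "HOL-Probability.Probability"
begin

text \<open>
  Circularly symmetric complex Gaussian laws. A scalar of variance \<open>v\<close> has independent real and
  imaginary parts of variance \<open>v / 2\<close> each; the vector noise has identity covariance, i.e. i.i.d.
  components of variance \<open>1\<close>. Here \<open>lborel\<close> on \<^typ>\<open>complex ^ 'n\<close> is Lebesgue measure on the
  underlying real space of dimension \<open>2 * CARD('n)\<close>, and the norm is the Euclidean one.
\<close>

definition complex_gaussian :: "real \<Rightarrow> complex measure" where
  "complex_gaussian v =
     density lborel (\<lambda>x. ennreal (exp (- (cmod x)\<^sup>2 / v) / (pi * v)))"

definition complex_gaussian_noise :: "(complex ^ 'n) measure" where
  "complex_gaussian_noise =
     density lborel (\<lambda>w. ennreal (exp (- (norm w)\<^sup>2) / pi ^ CARD('n)))"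

text \<open>
  Input laws of \<open>(u, x)\<close>, where the message space is an arbitrary measurable space \<open>U\<close> (only its
  carrier and its \<open>\<sigma>\<close>-algebra matter). The power is a nonnegative integral, so that an input
  of infinite power is not admissible.
\<close>

definition admissible_inputs :: "'u measure \<Rightarrow> real \<Rightarrow> ('u \<times> complex) measure set" where
  "admissible_inputs U P =
     {p. prob_space p \<and> sets p = sets (U \<Otimes>\<^sub>M borel) \<and>
         (\<integral>\<^sup>+(u, x). ennreal ((cmod x)\<^sup>2) \<partial>p) \<le> ennreal P}"

text \<open>
  Mutual information in bits between the message and the observation \<open>x c + w\<close> for the fixed
  channel state \<open>c\<close>. As the channel is independent of \<open>(u, x)\<close> and of the noise, conditioning on
  its value being \<open>c\<close> amounts to substituting \<open>c\<close>. The library's real-valued mutual information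
  would be \<open>0\<close> if the divergence were infinite; on admissible inputs it is always finite, being
  at most \<open>log 2 (1 + P * (norm c)\<^sup>2)\<close>.
\<close>

definition instantaneous_information ::
    "'u measure \<Rightarrow> ('u \<times> complex) measure \<Rightarrow> complex ^ 'n \<Rightarrow> real" where
  "instantaneous_information U p c =
     prob_space.mutual_information (p \<Otimes>\<^sub>M complex_gaussian_noise) 2 U borel
       (\<lambda>((u, x), w). u) (\<lambda>((u, x), w). x *s c + w)"

text \<open>
  The channel vectors \<open>h\<close> and \<open>g\<close> are random vectors on the probability space \<open>M\<close>, with an arbitrary
  joint law. The expectation of the nonnegative random variable may be \<open>\<infinity>\<close>.
\<close>

definition EPSR ::
    "'w measure \<Rightarrow> ('w \<Rightarrow> complex ^ 'b) \<Rightarrow> ('w \<Rightarrow> complex ^ 'e) \<Rightarrow>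
     'u measure \<Rightarrow> ('u \<times> complex) measure \<Rightarrow> ennreal" where
  "EPSR M h g U p =
     (\<integral>\<^sup>+\<omega>. ennreal (max 0 (instantaneous_information U p (h \<omega>) -
                            instantaneous_information U p (g \<omega>))) \<partial>M)"

text \<open>The law of \<open>(x, x)\<close>, i.e. no precoding, for \<open>x\<close> Gaussian of variance \<open>P\<close>.\<close>

definition gaussian_input :: "real \<Rightarrow> (complex \<times> complex) measure" where
  "gaussian_input P =
     distr (complex_gaussian P) (borel \<Otimes>\<^sub>M borel) (\<lambda>x. (x, x))"

end

theory Submission
  imports Defs
begin

text \<open>
  If \<open>norm d \<le> norm c\<close>, the channel \<open>d\<close> is a degraded version of \<open>c\<close>: up to a rotation of the
  noise, its output is a function of the output of \<open>c\<close> and of independent noise. Write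
  \<open>\<phi>\<close> for the noise density, \<open>p\<^sub>c\<close> for the output density of the given input and \<open>q\<^sub>c\<close> for that
  of the Gaussian input. Then
  \<open>E log (\<phi> (y - x c) / q\<^sub>c y) = I(u; y) + I(x; y | u) + D(p\<^sub>c, q\<^sub>c)\<close>,
  where each term on the right is a divergence and hence, by data processing, decreases when \<open>c\<close>
  is replaced by \<open>d\<close>. So \<open>I(u; y) - I(u; z)\<close> is nonnegative and at most the difference of the left
  sides, which depend only on \<open>Q = E \<bar>x\<bar>\<^sup>2\<close>; in nats they are
  \<open>ln (1 + P (norm c)\<^sup>2) + (norm c)\<^sup>2 (Q - P) / (1 + P (norm c)\<^sup>2)\<close>.
  As \<open>Q \<le> P\<close>, the bound \<open>log ((1 + P (norm c)\<^sup>2) / (1 + P (norm d)\<^sup>2))\<close> follows pointwise in the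
  channel state.
\<close>

text \<open>Data processing alone yields only the sign of \<open>I(u; y) - I(u; z)\<close>. The
  upper bound comes from the two companion terms: they decrease as well, so the total drops by at
  least as much as the information does. The reference input has the full power \<open>P\<close>
  rather than \<open>Q\<close>, so that the logarithms of the bound appear at once; the price is the
  term with \<open>Q - P\<close>, which has the right sign because \<open>t / (1 + P * t)\<close>
  increases in \<open>t\<close>.

  Two obstacles shape the formulation. \<open>KL_divergence\<close> is a Bochner integral, equal to
  \<open>0\<close> on nonintegrable integrands, so integrability accompanies every inequality; all
  of it is derived from the finite power, which makes the Gaussian log ratio integrable. And the
  message space is arbitrary, so a regular conditional law given \<open>u\<close> may fail to exist;
  \<open>I(x; y | u)\<close> is therefore a divergence between two laws of
  \<open>((u, x), y)\<close>, the second of which is given by a Radon-Nikodym density. Differential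
  entropies never occur.\<close>

lemma measure_eqI_nn_integral:
  assumes "sets A = sets B"
    and "\<And>h. h \<in> borel_measurable A \<Longrightarrow> (\<integral>\<^sup>+x. h x \<partial>A) = (\<integral>\<^sup>+x. h x \<partial>B)"
  shows "A = B"
proof (rule measure_eqI)
  fix X assume X: "X \<in> sets A"
  then show "emeasure A X = emeasure B X"
    using assms(2)[of "indicator X"] assms(1) by simp
qed fact

text \<open>Rectangles are an intersection-stable generator. This serves
  \<open>cond_indep_law\<close>, whose degraded image is compared one output set at a time, through
  conditional probabilities given the message.\<close>

lemma finite_measure_eqI_rectangles:
  assumes "finite_measure M" and sets: "sets M = sets (A \<Otimes>\<^sub>M B)" "sets N = sets (A \<Otimes>\<^sub>M B)"
    and eq: "\<And>X Y. X \<in> sets A \<Longrightarrow> Y \<in> sets B \<Longrightarrow> emeasure M (X \<times> Y) = emeasure N (X \<times> Y)"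
  shows "M = N"
proof (rule measure_eqI_generator_eq[OF Int_stable_pair_measure_generator[of A B] _ _ _ _ _ _, where A = "\<lambda>_::nat. space A \<times> space B"])
  interpret finite_measure M by fact
  show "{X \<times> Y | X Y. X \<in> sets A \<and> Y \<in> sets B} \<subseteq> Pow (space A \<times> space B)"
    using sets.space_closed[of A] sets.space_closed[of B] by auto
  show "sets M = sigma_sets (space A \<times> space B) {X \<times> Y | X Y. X \<in> sets A \<and> Y \<in> sets B}"
    "sets N = sigma_sets (space A \<times> space B) {X \<times> Y | X Y. X \<in> sets A \<and> Y \<in> sets B}"
    by (simp_all add: sets sets_pair_measure)
  show "emeasure M (space A \<times> space B) \<noteq> \<infinity>" by simp
qed (use eq in auto)

lemma distr_pair_snd:
  assumes "prob_space N" "sigma_finite_measure M"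
  shows "distr (N \<Otimes>\<^sub>M M) M snd = M"
proof (rule measure_eqI)
  interpret N: prob_space N by fact
  interpret M: sigma_finite_measure M by fact
  fix A assume "A \<in> sets (distr (N \<Otimes>\<^sub>M M) M snd)"
  then have A: "A \<in> sets M" by simp
  then have "snd -` A \<inter> space (N \<Otimes>\<^sub>M M) = space N \<times> A"
    using sets.sets_into_space by (fastforce simp: space_pair_measure)
  with A show "emeasure (distr (N \<Otimes>\<^sub>M M) M snd) A = emeasure M A"
    by (simp add: emeasure_distr M.emeasure_pair_measure_Times N.emeasure_space_1)
qed simp

subsection \<open>Data processing for the Kullback-Leibler divergence\<close>

text \<open>Replaces \<open>RN_deriv\<close> by a real function that is nonnegative everywhere, so
  that logarithms and quotients can be formed without exceptional null sets.\<close>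

lemma obtain_real_density:
  assumes "prob_space Q" "prob_space P" "sets P = sets Q" "absolutely_continuous Q P"
  obtains r :: "'a \<Rightarrow> real" where "r \<in> borel_measurable Q" "\<And>x. 0 \<le> r x"
    "P = density Q (\<lambda>x. ennreal (r x))" "AE x in P. 0 < r x"
proof -
  interpret Q: prob_space Q by fact
  interpret P: prob_space P by fact
  obtain D where D: "D \<in> borel_measurable Q" "AE x in Q. RN_deriv Q P x = ennreal (D x)"
     "AE x in P. 0 < D x" "\<And>x. 0 \<le> D x"
    using Q.real_RN_deriv[OF P.finite_measure_axioms assms(4,3)] by blast
  have "P = density Q (RN_deriv Q P)"
    using Q.density_RN_deriv[OF assms(4,3)] ..
  also have "\<dots> = density Q (\<lambda>x. ennreal (D x))"
    using D by (intro density_cong) auto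
  finally show thesis using D that by blast
qed

lemma entropy_density_density:
  fixes r :: "'a \<Rightarrow> real"
  assumes "prob_space Q" and r: "r \<in> borel_measurable Q" "\<And>x. 0 \<le> r x"
  shows "AE x in density Q (\<lambda>x. ennreal (r x)).
    entropy_density b Q (density Q (\<lambda>x. ennreal (r x))) x = log b (r x)"
proof -
  interpret Q: prob_space Q by fact
  have "AE x in Q. ennreal (r x) = RN_deriv Q (density Q (\<lambda>x. ennreal (r x))) x"
    using r by (intro Q.RN_deriv_unique) auto
  then have "AE x in density Q (\<lambda>x. ennreal (r x)). ennreal (r x) = RN_deriv Q (density Q (\<lambda>x. ennreal (r x))) x"
    using r by (subst AE_density) auto
  then show ?thesis
  proof eventually_elim
    case (elim x)
    show ?case unfolding entropy_density_def comp_def elim[symmetric] using r by simp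
  qed
qed

text \<open>Divergences are evaluated through explicit densities. The equivalence of integrability
  is recorded beside the value, because the value alone says nothing when the Bochner integral
  defaults to \<open>0\<close>.\<close>

lemma KL_divergence_density:
  fixes r :: "'a \<Rightarrow> real"
  assumes "prob_space Q" and [measurable]: "r \<in> borel_measurable Q" and r: "\<And>x. 0 \<le> r x"
    and P: "P = density Q (\<lambda>x. ennreal (r x))"
  shows "integrable P (entropy_density b Q P) \<longleftrightarrow> integrable P (\<lambda>x. log b (r x))"
    and "KL_divergence b Q P = (\<integral>x. log b (r x) \<partial>P)"
proof -
  have ae: "AE x in P. entropy_density b Q P x = log b (r x)"
    unfolding P by (rule entropy_density_density) (use assms in auto)
  have [measurable_cong]: "sets P = sets Q" by (simp add: P)
  have m: "entropy_density b Q P \<in> borel_measurable P"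
    using measurable_entropy_density[of b Q P] measurable_cong_sets[OF \<open>sets P = sets Q\<close>, of borel borel] by simp
  show "integrable P (entropy_density b Q P) \<longleftrightarrow> integrable P (\<lambda>x. log b (r x))"
    by (intro integrable_cong_AE ae m) measurable
  show "KL_divergence b Q P = (\<integral>x. log b (r x) \<partial>P)"
    unfolding KL_divergence_def by (intro integral_cong_AE ae m) measurable
qed

lemma absolutely_continuous_distr:
  assumes "absolutely_continuous Q P" "sets P = sets Q" and T[measurable]: "T \<in> Q \<rightarrow>\<^sub>M N"
  shows "absolutely_continuous (distr Q N T) (distr P N T)"
proof -
  have [measurable]: "T \<in> P \<rightarrow>\<^sub>M N"
    using T measurable_cong_sets[OF assms(2) refl, of N] by simp
  have sp: "space P = space Q" using assms(2) sets_eq_imp_space_eq by blast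
  show ?thesis
    unfolding absolutely_continuous_def
  proof
    fix A assume A: "A \<in> null_sets (distr Q N T)"
    then have [measurable]: "A \<in> sets N" by (auto simp: null_sets_def)
    have "T -` A \<inter> space Q \<in> null_sets Q"
      using A by (auto simp: null_sets_def emeasure_distr)
    then have "T -` A \<inter> space P \<in> null_sets P"
      using assms(1) by (auto simp: absolutely_continuous_def sp)
    then show "A \<in> null_sets (distr P N T)"
      by (auto simp: null_sets_def emeasure_distr)
  qed
qed

text \<open>
  With \<open>r\<close> and \<open>s\<close> the densities before and after the processing \<open>T\<close>, the elementary
  inequality \<open>ln (r / s) \<ge> 1 - s / r\<close> suffices, because \<open>s / r\<close> has mean at most \<open>1\<close> under \<open>P\<close>.
\<close>

lemma KL_divergence_data_processing:
  assumes b: "1 < b" and "prob_space Q" "prob_space P"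
    and sets: "sets P = sets Q" and ac: "absolutely_continuous Q P"
    and int: "integrable P (entropy_density b Q P)" and T[measurable]: "T \<in> Q \<rightarrow>\<^sub>M N"
  shows "integrable (distr P N T) (entropy_density b (distr Q N T) (distr P N T))"
    and "KL_divergence b (distr Q N T) (distr P N T) \<le> KL_divergence b Q P"
proof -
  interpret Q: prob_space Q by fact
  interpret P: prob_space P by fact
  note [measurable_cong] = sets
  have [measurable]: "T \<in> P \<rightarrow>\<^sub>M N"
    using T measurable_cong_sets[OF sets refl, of N] by simp
  have TQ: "prob_space (distr Q N T)" by (rule Q.prob_space_distr) measurable
  have TP: "prob_space (distr P N T)" by (rule P.prob_space_distr) measurable
  have TPQ: "absolutely_continuous (distr Q N T) (distr P N T)"
    by (rule absolutely_continuous_distr) fact+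
  obtain r :: "'a \<Rightarrow> real" where r[measurable]: "r \<in> borel_measurable Q" and r0: "\<And>x. 0 \<le> r x"
    and P: "P = density Q (\<lambda>x. ennreal (r x))" and rpos: "AE x in P. 0 < r x"
    using obtain_real_density[OF assms(2,3) sets ac] by metis
  obtain s :: "'b \<Rightarrow> real" where s': "s \<in> borel_measurable (distr Q N T)" and s0: "\<And>x. 0 \<le> s x"
    and S: "distr P N T = density (distr Q N T) (\<lambda>x. ennreal (s x))" and spos': "AE x in distr P N T. 0 < s x"
    using obtain_real_density[OF TQ TP _ TPQ] by (metis sets_distr)
  have s[measurable]: "s \<in> borel_measurable N" using s' by simp
  have spos: "AE x in P. 0 < s (T x)" using spos' by (subst (asm) AE_distr_iff) auto
  have "(\<integral>\<^sup>+x. ennreal (s (T x) / r x) \<partial>P) = (\<integral>\<^sup>+x. ennreal (r x) * ennreal (s (T x) / r x) \<partial>Q)"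
    unfolding P by (subst nn_integral_density) auto
  \<comment> \<open>Only \<open>\<le>\<close>: where \<open>r\<close> vanishes,
    \<open>r * (s / r)\<close> is \<open>0\<close> instead of \<open>s\<close>.\<close>
  also have "\<dots> \<le> (\<integral>\<^sup>+x. ennreal (s (T x)) \<partial>Q)"
    by (intro nn_integral_mono) (auto simp: ennreal_mult'[symmetric] r0 s0)
  also have "\<dots> = (\<integral>\<^sup>+x. ennreal (s x) \<partial>distr Q N T)"
    by (subst nn_integral_distr) auto
  also have "\<dots> = emeasure (density (distr Q N T) (\<lambda>x. ennreal (s x))) (space N)"
    by (subst emeasure_density) (auto intro!: nn_integral_cong)
  also have "\<dots> = 1" unfolding S[symmetric] using prob_space.emeasure_space_1[OF TP] by simp
  finally have le1: "(\<integral>\<^sup>+x. ennreal (s (T x) / r x) \<partial>P) \<le> 1" .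
  have [measurable]: "r \<in> borel_measurable P" by simp
  have iq: "integrable P (\<lambda>x. s (T x) / r x)"
    by (rule integrableI_bounded) (use le1 r0 s0 in \<open>auto simp: order.strict_trans1[OF le1]\<close>)
  have iq1: "(\<integral>x. s (T x) / r x \<partial>P) \<le> 1"
    using le1 iq r0 s0 by (subst (asm) nn_integral_eq_integral) auto
  \<comment> \<open>Controls the negative part of \<open>ln (s (T x))\<close>, again through
    \<open>ln t \<le> t - 1\<close>: as \<open>s\<close> is the density of the image of
    \<open>P\<close>, its reciprocal has mean at most \<open>1\<close> there.\<close>
  have iS: "(\<integral>\<^sup>+x. ennreal (1 / s (T x)) \<partial>P) \<le> 1"
  proof -
    have "(\<integral>\<^sup>+x. ennreal (1 / s (T x)) \<partial>P) = (\<integral>\<^sup>+x. ennreal (1 / s x) \<partial>distr P N T)"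
      by (subst nn_integral_distr) auto
    also have "\<dots> = (\<integral>\<^sup>+x. ennreal (s x) * ennreal (1 / s x) \<partial>distr Q N T)"
      unfolding S by (subst nn_integral_density) auto
    also have "\<dots> \<le> (\<integral>\<^sup>+x. 1 \<partial>distr Q N T)"
      by (intro nn_integral_mono) (auto simp: ennreal_mult'[symmetric] s0)
    also have "\<dots> = 1" using prob_space.emeasure_space_1[OF TQ] by simp
    finally show ?thesis .
  qed
  have iis: "integrable P (\<lambda>x. 1 / s (T x))"
    by (rule integrableI_bounded) (use s0 in \<open>auto simp: order.strict_trans1[OF iS]\<close>)
  have ir: "integrable P (\<lambda>x. log b (r x))"
    using KL_divergence_density(1)[OF assms(2) r r0 P] int by simp
  have lb: "AE x in P. ln b * log b (s (T x)) \<le> ln b * log b (r x) + s (T x) / r x - 1"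
    using rpos spos
  proof eventually_elim
    case (elim x)
    have "ln (s (T x) / r x) \<le> s (T x) / r x - 1"
      by (rule ln_le_minus_one) (use elim in auto)
    then show ?case using elim b by (simp add: log_def ln_div)
  qed
  have ub: "AE x in P. - (ln b * log b (s (T x))) \<le> 1 / s (T x) - 1"
    using spos
  proof eventually_elim
    case (elim x)
    have "ln (1 / s (T x)) \<le> 1 / s (T x) - 1"
      by (rule ln_le_minus_one) (use elim in auto)
    then show ?case using elim b by (simp add: log_def ln_div)
  qed
  have ils: "integrable P (\<lambda>x. ln b * log b (s (T x)))"
  proof (rule Bochner_Integration.integrable_bound)
    show "integrable P (\<lambda>x. \<bar>ln b * log b (r x)\<bar> + s (T x) / r x + 1 + 1 / s (T x))"
      by (intro Bochner_Integration.integrable_add iq iis integrable_abs integrable_mult_right ir) auto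
    show "AE x in P. norm (ln b * log b (s (T x))) \<le> norm (\<bar>ln b * log b (r x)\<bar> + s (T x) / r x + 1 + 1 / s (T x))"
      using lb ub rpos spos
    proof eventually_elim
      case (elim x)
      have "0 \<le> s (T x) / r x" "0 \<le> 1 / s (T x)" using r0 s0 by auto
      then show ?case using elim(1,2) unfolding real_norm_def by linarith
    qed
  qed measurable
  have ils': "integrable P (\<lambda>x. log b (s (T x)))"
    using integrable_mult_right[OF ils, of "1 / ln b"] b by simp
  have 1: "integrable (distr P N T) (\<lambda>x. log b (s x))"
    using ils' by (subst integrable_distr_eq) auto
  then show "integrable (distr P N T) (entropy_density b (distr Q N T) (distr P N T))"
    using KL_divergence_density(1)[OF TQ s' s0 S] by blast
  have "ln b * (\<integral>x. log b (s (T x)) \<partial>P) = (\<integral>x. ln b * log b (s (T x)) \<partial>P)"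
    by simp
  also have "\<dots> \<le> (\<integral>x. ln b * log b (r x) + s (T x) / r x - 1 \<partial>P)"
    using ils ir iq lb by (intro integral_mono_AE) auto
  also have "\<dots> = ln b * (\<integral>x. log b (r x) \<partial>P) + (\<integral>x. s (T x) / r x \<partial>P) - 1"
    using ir iq P.prob_space by simp
  also have "\<dots> \<le> ln b * (\<integral>x. log b (r x) \<partial>P)"
    using iq1 by simp
  finally have "(\<integral>x. log b (s (T x)) \<partial>P) \<le> (\<integral>x. log b (r x) \<partial>P)"
    using b by simp
  moreover have "(\<integral>x. log b (s x) \<partial>distr P N T) = (\<integral>x. log b (s (T x)) \<partial>P)"
    by (subst integral_distr) auto
  ultimately show "KL_divergence b (distr Q N T) (distr P N T) \<le> KL_divergence b Q P"
    using KL_divergence_density(2)[OF TQ s' s0 S, of b] KL_divergence_density(2)[OF assms(2) r r0 P, of b] by simp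
qed

text \<open>Data processing for a randomised map. Attaching independent noise \<open>R\<close> to
  both laws keeps the density, now read as \<open>r (fst x)\<close>, and hence the divergence and
  its integrability; what remains is a deterministic map of the pair.\<close>

lemma KL_divergence_data_processing_noise:
  assumes b: "1 < b" and Q: "prob_space Q" and P: "prob_space P" and R: "prob_space R"
    and sets: "sets P = sets Q" and ac: "absolutely_continuous Q P"
    and int: "integrable P (entropy_density b Q P)" and T[measurable]: "T \<in> Q \<Otimes>\<^sub>M R \<rightarrow>\<^sub>M N"
  shows "KL_divergence b (distr (Q \<Otimes>\<^sub>M R) N T) (distr (P \<Otimes>\<^sub>M R) N T) \<le> KL_divergence b Q P"
proof -
  interpret Q: prob_space Q by fact
  interpret P: prob_space P by fact
  interpret R: prob_space R by fact
  interpret QR: pair_prob_space Q R ..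
  interpret PR: pair_prob_space P R ..
  note [measurable_cong] = sets
  obtain r :: "'a \<Rightarrow> real" where r[measurable]: "r \<in> borel_measurable Q" and r0: "\<And>x. 0 \<le> r x"
    and Pr: "P = density Q (\<lambda>x. ennreal (r x))"
    using obtain_real_density[OF Q P sets ac] by metis
  have 1: "density R (\<lambda>x. 1) = R" by (rule density_1)
  have PR: "P \<Otimes>\<^sub>M R = density (Q \<Otimes>\<^sub>M R) (\<lambda>x. ennreal (r (fst x)))"
    using pair_measure_density[of "\<lambda>x. ennreal (r x)" Q "\<lambda>x. 1" R] R.sigma_finite_measure_axioms
    by (simp add: 1 Pr case_prod_unfold)
  have ac': "absolutely_continuous (Q \<Otimes>\<^sub>M R) (P \<Otimes>\<^sub>M R)"
    unfolding PR by (rule absolutely_continuousI_density) measurable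
  have fst: "distr (P \<Otimes>\<^sub>M R) P fst = P"
    by (rule R.distr_pair_fst)
  have [measurable]: "(\<lambda>x. log b (r x)) \<in> borel_measurable P" by measurable
  have "integrable P (\<lambda>x. log b (r x))"
    using KL_divergence_density(1)[OF Q r r0 Pr] int by simp
  then have "integrable (distr (P \<Otimes>\<^sub>M R) P fst) (\<lambda>x. log b (r x))" unfolding fst .
  then have i: "integrable (P \<Otimes>\<^sub>M R) (\<lambda>x. log b (r (fst x)))"
    by (subst (asm) integrable_distr_eq) auto
  have "KL_divergence b (distr (Q \<Otimes>\<^sub>M R) N T) (distr (P \<Otimes>\<^sub>M R) N T) \<le> KL_divergence b (Q \<Otimes>\<^sub>M R) (P \<Otimes>\<^sub>M R)"
  proof (rule KL_divergence_data_processing[OF b QR.prob_space_axioms PR.prob_space_axioms _ ac' _ T])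
    show "sets (P \<Otimes>\<^sub>M R) = sets (Q \<Otimes>\<^sub>M R)" using sets by (rule sets_pair_measure_cong) simp
    show "integrable (P \<Otimes>\<^sub>M R) (entropy_density b (Q \<Otimes>\<^sub>M R) (P \<Otimes>\<^sub>M R))"
      using i by (subst KL_divergence_density(1)[OF QR.prob_space_axioms _ _ PR]) (auto simp: r0)
  qed
  also have "\<dots> = (\<integral>x. log b (r (fst x)) \<partial>(P \<Otimes>\<^sub>M R))"
    by (rule KL_divergence_density(2)[OF QR.prob_space_axioms _ _ PR]) (auto simp: r0)
  also have "\<dots> = (\<integral>x. log b (r x) \<partial>distr (P \<Otimes>\<^sub>M R) P fst)"
    by (rule integral_distr[symmetric]) auto
  also have "\<dots> = KL_divergence b Q P"
    unfolding fst using KL_divergence_density(2)[OF Q r r0 Pr, of b] by simp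
  finally show ?thesis .
qed

subsection \<open>The standard Gaussian measure\<close>

lemma borel_measurable_linear:
  fixes f :: "'a::euclidean_space \<Rightarrow> 'b::real_normed_vector"
  assumes "linear f"
  shows "f \<in> borel_measurable borel"
  using assms by (intro borel_measurable_continuous_onI linear_continuous_on linear_conv_bounded_linear[THEN iffD1])

lemma nn_integral_lborel_reflect:
  fixes a :: "'a::euclidean_space"
  assumes [measurable]: "h \<in> borel_measurable borel"
  shows "(\<integral>\<^sup>+x. h (a - x) \<partial>lborel) = (\<integral>\<^sup>+x. h x \<partial>lborel)"
proof -
  have "lborel = distr lborel borel (\<lambda>x::'a. a - x)"
    using lborel_affine[of "-1" a] by (simp add: density_1)
  then have "(\<integral>\<^sup>+x. h x \<partial>lborel) = (\<integral>\<^sup>+x. h x \<partial>distr lborel borel (\<lambda>x::'a. a - x))"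
    by simp
  also have "\<dots> = (\<integral>\<^sup>+x. h (a - x) \<partial>lborel)" by (subst nn_integral_distr) auto
  finally show ?thesis ..
qed

lemma nn_integral_lborel_translate:
  fixes a :: "'a::euclidean_space"
  assumes [measurable]: "h \<in> borel_measurable borel"
  shows "(\<integral>\<^sup>+x. h (x + a) \<partial>lborel) = (\<integral>\<^sup>+x. h x \<partial>lborel)"
proof -
  have "(\<integral>\<^sup>+x. h x \<partial>lborel) = (\<integral>\<^sup>+x. h x \<partial>distr lborel borel ((+) a))"
    by (simp add: lborel_distr_plus)
  also have "\<dots> = (\<integral>\<^sup>+x. h (x + a) \<partial>lborel)"
    by (subst nn_integral_distr) (auto simp: add.commute)
  finally show ?thesis ..
qed

text \<open>Uniqueness of Haar measure, normalised on the unit ball, which \<open>f\<close> preserves.\<close>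

lemma lborel_distr_orthogonal_transformation:
  fixes f :: "'a::euclidean_space \<Rightarrow> 'a"
  assumes f: "orthogonal_transformation f"
  shows "distr lborel borel f = lborel"
proof (rule measure_eqI)
  have lin: "linear f" using f by (rule orthogonal_transformation_linear)
  have [measurable]: "f \<in> borel_measurable borel"
    using lin by (rule borel_measurable_linear)
  \<comment> \<open>The image of Lebesgue measure under \<open>f\<close> is translation invariant:
    \<open>f\<close> is onto, so a shift by \<open>c\<close> is the image of a shift by some
    \<open>d\<close>.\<close>
  have shift: "(\<integral>\<^sup>+x. h (f x + c) \<partial>lborel) = (\<integral>\<^sup>+x. h (f x) \<partial>lborel)"
    if [measurable]: "h \<in> borel_measurable borel" for h and c :: 'a
  proof -
    obtain d where d: "c = f d"
      using orthogonal_transformation_surj[OF f] by (metis surjD)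
    have "(\<integral>\<^sup>+x. h (f x + c) \<partial>lborel) = (\<integral>\<^sup>+x. h (f (x + d)) \<partial>lborel)"
      by (simp add: d linear_add[OF lin])
    also have "\<dots> = (\<integral>\<^sup>+x. h (f x) \<partial>lborel)"
      by (rule nn_integral_lborel_translate) measurable
    finally show ?thesis .
  qed
  fix A :: "'a set" assume "A \<in> sets (distr lborel borel f)"
  then have A[measurable]: "A \<in> sets borel" by simp
  define B where "B = ball (0::'a) 1"
  have [measurable]: "B \<in> sets borel" by (simp add: B_def)
  have fB: "f -` B = B"
    using orthogonal_transformation_norm[OF f] by (auto simp: B_def)
  have I: "(\<integral>\<^sup>+x. indicator C (f x) \<partial>lborel) = emeasure (distr lborel borel f) C"
    if [measurable]: "C \<in> sets borel" for C
    using nn_integral_distr[of f lborel borel "indicator C"] by simp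
  \<comment> \<open>The pairs \<open>(x, y)\<close> with \<open>f x \<in> A\<close> and
    \<open>y + f x \<in> B\<close> are measured in two ways. Invariance of Lebesgue measure in
    \<open>y\<close> gives this product; invariance of the image measure in \<open>x\<close> gives
    the product with \<open>A\<close> and \<open>B\<close> exchanged. The factor for
    \<open>B\<close> is the same in both, positive and finite, and cancels.\<close>
  have "emeasure (distr lborel borel f) A * emeasure lborel B
      = (\<integral>\<^sup>+x. indicator A (f x) * (\<integral>\<^sup>+y. indicator B y \<partial>lborel) \<partial>lborel)"
    by (simp add: nn_integral_multc I)
  also have "\<dots> = (\<integral>\<^sup>+x. indicator A (f x) * (\<integral>\<^sup>+y. indicator B (y + f x) \<partial>lborel) \<partial>lborel)"
    by (subst nn_integral_lborel_translate[of "indicator B"]) auto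
  also have "\<dots> = (\<integral>\<^sup>+x. (\<integral>\<^sup>+y. indicator A (f x) * indicator B (y + f x) \<partial>lborel) \<partial>lborel)"
    by (subst nn_integral_cmult) auto
  also have "\<dots> = (\<integral>\<^sup>+y. (\<integral>\<^sup>+x. indicator A (f x) * indicator B (y + f x) \<partial>lborel) \<partial>lborel)"
    by (rule lborel_pair.Fubini') measurable
  also have "\<dots> = (\<integral>\<^sup>+y. (\<integral>\<^sup>+x. indicator A (f x - y) * indicator B (f x) \<partial>lborel) \<partial>lborel)"
  proof (rule nn_integral_cong)
    fix y :: 'a
    have "(\<integral>\<^sup>+x. indicator A (f x) * indicator B (y + f x) \<partial>lborel) =
      (\<integral>\<^sup>+x. (\<lambda>t. indicator A (t - y) * indicator B t) (f x + y) \<partial>lborel)"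
      by (simp add: add.commute)
    also have "\<dots> = (\<integral>\<^sup>+x. indicator A (f x - y) * indicator B (f x) \<partial>lborel)"
      by (rule shift) measurable
    finally show "(\<integral>\<^sup>+x. indicator A (f x) * indicator B (y + f x) \<partial>lborel) = \<dots>" .
  qed
  also have "\<dots> = (\<integral>\<^sup>+x. (\<integral>\<^sup>+y. indicator A (f x - y) * indicator B (f x) \<partial>lborel) \<partial>lborel)"
    by (rule lborel_pair.Fubini') measurable
  also have "\<dots> = (\<integral>\<^sup>+x. (\<integral>\<^sup>+y. indicator A (f x - y) \<partial>lborel) * indicator B (f x) \<partial>lborel)"
    by (subst nn_integral_multc) auto
  also have "\<dots> = (\<integral>\<^sup>+x. (\<integral>\<^sup>+y. indicator A y \<partial>lborel) * indicator B (f x) \<partial>lborel)"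
    by (subst nn_integral_lborel_reflect[of "indicator A"]) auto
  also have "\<dots> = emeasure lborel A * emeasure (distr lborel borel f) B"
    by (simp add: nn_integral_cmult I)
  also have "emeasure (distr lborel borel f) B = emeasure lborel B"
    by (simp add: emeasure_distr fB)
  finally have "emeasure (distr lborel borel f) A * emeasure lborel B = emeasure lborel A * emeasure lborel B" .
  moreover have "emeasure lborel B \<noteq> \<infinity>"
    using emeasure_lborel_ball_finite[of "0::'a" 1] by (simp add: B_def)
  moreover have "emeasure lborel B \<noteq> 0"
    using content_ball_pos[of 1 "0::'a"] by (auto simp: B_def measure_def)
  ultimately show "emeasure (distr lborel borel f) A = emeasure lborel A"
    by (simp add: mult.commute[of _ "emeasure lborel B"] ennreal_mult_cancel_left)
qed simp

text \<open>Each real coordinate has variance \<open>1 / 2\<close>. On \<open>complex ^ 'n\<close>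
  this is the channel noise, since \<open>DIM\<close> is \<open>2 * CARD('n)\<close> there. The
  general type covers the noise vectors, the scalar input up to scaling, and the pair of two noise
  vectors on which a rotation acts.\<close>

definition std_gaussian :: "'a::euclidean_space measure" where
  "std_gaussian = density lborel (\<lambda>x. ennreal (exp (- (norm x)\<^sup>2) / sqrt pi ^ DIM('a)))"

lemma sets_std_gaussian[measurable_cong, simp]: "sets std_gaussian = sets borel"
  by (simp add: std_gaussian_def)

lemma space_std_gaussian[simp]: "space std_gaussian = UNIV"
  by (simp add: std_gaussian_def)

lemma complex_gaussian_noise_eq: "complex_gaussian_noise = std_gaussian"
  unfolding complex_gaussian_noise_def std_gaussian_def
  by (simp add: power_mult mult.commute[of _ 2])

lemma distr_std_gaussian_orthogonal_transformation:
  fixes f :: "'a::euclidean_space \<Rightarrow> 'a"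
  assumes f: "orthogonal_transformation f"
  shows "distr std_gaussian borel f = std_gaussian"
proof -
  have lin: "linear f" using f by (rule orthogonal_transformation_linear)
  have [measurable]: "f \<in> borel_measurable borel"
    using lin by (rule borel_measurable_linear)
  let ?d = "\<lambda>x::'a. ennreal (exp (- (norm x)\<^sup>2) / sqrt pi ^ DIM('a))"
  have "std_gaussian = density (distr lborel borel f) ?d"
    by (simp add: lborel_distr_orthogonal_transformation[OF f] std_gaussian_def)
  also have "\<dots> = distr (density lborel (\<lambda>x. ?d (f x))) borel f"
    by (rule density_distr) auto
  also have "\<dots> = distr std_gaussian borel f"
    by (simp add: std_gaussian_def orthogonal_transformation_norm[OF f])
  finally show ?thesis ..
qed

lemma nn_integral_exp_square:
  "(\<integral>\<^sup>+t. ennreal (exp (- t\<^sup>2) / sqrt pi) \<partial>lborel) = 1"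
  "(\<integral>\<^sup>+t. ennreal (t\<^sup>2 * (exp (- t\<^sup>2) / sqrt pi)) \<partial>lborel) = ennreal (1 / 2)"
proof -
  have eq: "normal_density 0 (1 / sqrt 2) t = exp (- t\<^sup>2) / sqrt pi" for t
    by (simp add: normal_density_def power_divide)
  show "(\<integral>\<^sup>+t. ennreal (exp (- t\<^sup>2) / sqrt pi) \<partial>lborel) = 1"
    using prob_space.emeasure_space_1[OF prob_space_normal_density[of "1 / sqrt 2" 0]]
    by (simp add: emeasure_density eq)
  have h: "has_bochner_integral lborel (\<lambda>t. t\<^sup>2 * (exp (- t\<^sup>2) / sqrt pi)) (1 / 2)"
    using normal_moment_even[of "1 / sqrt 2" 0 1]
    by (rule has_bochner_integral_cong[THEN iffD1, rotated -1]) (simp_all add: eq power_divide)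
  have "(\<integral>\<^sup>+t. ennreal (t\<^sup>2 * (exp (- t\<^sup>2) / sqrt pi)) \<partial>lborel) = ennreal (\<integral>t. t\<^sup>2 * (exp (- t\<^sup>2) / sqrt pi) \<partial>lborel)"
    by (rule nn_integral_eq_integral[OF integrable.intros[OF h]]) simp
  then show "(\<integral>\<^sup>+t. ennreal (t\<^sup>2 * (exp (- t\<^sup>2) / sqrt pi)) \<partial>lborel) = ennreal (1 / 2)"
    unfolding has_bochner_integral_integral_eq[OF h] .
qed

lemma std_gaussian_density_prod:
  fixes x :: "'a::euclidean_space"
  shows "exp (- (norm x)\<^sup>2) / sqrt pi ^ DIM('a) = (\<Prod>b\<in>Basis. exp (- (x \<bullet> b)\<^sup>2) / sqrt pi)"
proof -
  have "(norm x)\<^sup>2 = (\<Sum>b\<in>Basis. (x \<bullet> b)\<^sup>2)"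
    unfolding power2_norm_eq_inner by (subst euclidean_inner) (simp add: power2_eq_square)
  then show ?thesis by (simp add: exp_sum prod_dividef sum_negf[symmetric])
qed

lemma prob_space_std_gaussian: "prob_space (std_gaussian :: 'a::euclidean_space measure)"
proof
  have "emeasure (std_gaussian :: 'a measure) UNIV = (\<integral>\<^sup>+x. (\<Prod>b\<in>Basis. ennreal (exp (- ((x::'a) \<bullet> b)\<^sup>2) / sqrt pi)) \<partial>lborel)"
    unfolding std_gaussian_def by (subst emeasure_density) (auto simp: std_gaussian_density_prod prod_ennreal)
  also have "\<dots> = 1"
    by (subst nn_integral_lborel_prod) (auto simp: nn_integral_exp_square)
  finally show "emeasure (std_gaussian :: 'a measure) (space std_gaussian) = 1" by simp
qed

lemma std_gaussian_pair:
  "(std_gaussian :: 'a::euclidean_space measure) \<Otimes>\<^sub>M (std_gaussian :: 'b::euclidean_space measure) = std_gaussian"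
proof -
  interpret b: prob_space "std_gaussian :: 'b measure" by (rule prob_space_std_gaussian)
  show ?thesis
    unfolding std_gaussian_def
    apply (subst pair_measure_density)
    subgoal by simp
    subgoal by simp
    subgoal by (rule sigma_finite_lborel)
    subgoal using b.sigma_finite_measure_axioms by (simp add: std_gaussian_def)
    subgoal
      unfolding lborel_prod
      by (intro arg_cong2[where f = density] refl ext)
         (auto simp: norm_Pair ennreal_mult[symmetric] power_add exp_add[symmetric])
    done
qed

section \<open>Moments of the standard Gaussian measure\<close>

lemma std_gaussian_second_moment_Basis:
  fixes e :: "'a::euclidean_space"
  assumes "e \<in> Basis"
  shows "(\<integral>\<^sup>+x. ennreal ((x \<bullet> e)\<^sup>2) \<partial>std_gaussian) = ennreal (1 / 2)"
proof -
  let ?f = "\<lambda>b t. ennreal ((if b = e then t\<^sup>2 else 1) * (exp (- t\<^sup>2) / sqrt pi))"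
  have "ennreal (exp (- (norm x)\<^sup>2) / sqrt pi ^ DIM('a)) * ennreal ((x \<bullet> e)\<^sup>2) = (\<Prod>b\<in>Basis. ?f b (x \<bullet> b))" for x :: 'a
  proof -
    have "(\<Prod>b\<in>Basis. ?f b (x \<bullet> b)) = ennreal (\<Prod>b\<in>Basis. (if b = e then (x \<bullet> b)\<^sup>2 else 1) * (exp (- (x \<bullet> b)\<^sup>2) / sqrt pi))"
      by (subst prod_ennreal) auto
    also have "\<dots> = ennreal ((x \<bullet> e)\<^sup>2 * (exp (- (norm x)\<^sup>2) / sqrt pi ^ DIM('a)))"
      by (simp only: std_gaussian_density_prod prod.distrib) (simp add: assms)
    also have "\<dots> = ennreal (exp (- (norm x)\<^sup>2) / sqrt pi ^ DIM('a)) * ennreal ((x \<bullet> e)\<^sup>2)"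
      by (subst ennreal_mult'[symmetric]) (auto simp: mult.commute)
    finally show ?thesis ..
  qed
  then have "(\<integral>\<^sup>+x. ennreal ((x \<bullet> e)\<^sup>2) \<partial>std_gaussian) = (\<integral>\<^sup>+x. (\<Prod>b\<in>Basis. ?f b (x \<bullet> b)) \<partial>lborel)"
    unfolding std_gaussian_def by (subst nn_integral_density) auto
  also have "\<dots> = (\<Prod>b\<in>Basis. \<integral>\<^sup>+t. ?f b t \<partial>lborel)"
    by (rule nn_integral_lborel_prod) auto
  also have "\<dots> = (\<Prod>b\<in>(Basis::'a set). if b = e then ennreal (1 / 2) else 1)"
  proof (intro prod.cong refl)
    show "(\<integral>\<^sup>+t. ?f b t \<partial>lborel) = (if b = e then ennreal (1 / 2) else 1)" for b
      by (cases "b = e") (simp_all only: simp_thms if_True if_False mult_1 nn_integral_exp_square)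
  qed
  also have "\<dots> = ennreal (1 / 2)" using assms by simp
  finally show ?thesis .
qed

text \<open>The Householder reflection in the hyperplane orthogonal to \<open>v = a - b\<close>.
  Equality of the norms amounts to \<open>2 * (a \<bullet> v) = v \<bullet> v\<close>, which is
  exactly what sends \<open>a\<close> to \<open>b\<close>.\<close>

lemma orthogonal_transformation_exists_norm_eq:
  fixes a b :: "'a::euclidean_space"
  assumes "norm a = norm b"
  obtains f where "orthogonal_transformation f" "f a = b"
proof (cases "a = b")
  case True
  then show thesis using that[of "\<lambda>x. x"] by simp
next
  case False
  define v where "v = a - b"
  have v: "v \<bullet> v \<noteq> 0" using False by (simp add: v_def)
  define f where "f x = x - (2 * (x \<bullet> v) / (v \<bullet> v)) *\<^sub>R v" for x
  have "linear f"
    by (rule linearI) (auto simp: f_def inner_add_left algebra_simps add_divide_distrib)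
  moreover have "f x \<bullet> f y = x \<bullet> y" for x y
    using v by (simp add: f_def inner_diff_left inner_diff_right inner_commute field_simps)
  ultimately have "orthogonal_transformation f"
    by (simp add: orthogonal_transformation_def)
  moreover have "a \<bullet> a = b \<bullet> b" using assms by (simp add: dot_square_norm)
  then have "2 * (a \<bullet> v) = v \<bullet> v"
    by (simp add: v_def inner_diff_left inner_diff_right inner_commute)
  then have "f a = b" using v by (simp add: f_def) (simp add: v_def)
  ultimately show thesis using that by blast
qed

text \<open>Rotation invariance reduces an arbitrary direction to a multiple of one basis
  vector.\<close>

lemma std_gaussian_second_moment_nn:
  fixes b :: "'a::euclidean_space"
  shows "(\<integral>\<^sup>+x. ennreal ((x \<bullet> b)\<^sup>2) \<partial>std_gaussian) = ennreal ((norm b)\<^sup>2 / 2)"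
proof -
  obtain e :: 'a where e: "e \<in> Basis" using nonempty_Basis by blast
  obtain f where f: "orthogonal_transformation f" "f (norm b *\<^sub>R e) = b"
    using orthogonal_transformation_exists_norm_eq[of "norm b *\<^sub>R e" b] e by auto
  have [measurable]: "f \<in> borel_measurable borel"
    using orthogonal_transformation_linear[OF f(1)] by (rule borel_measurable_linear)
  have "(\<integral>\<^sup>+x. ennreal ((x \<bullet> b)\<^sup>2) \<partial>std_gaussian) = (\<integral>\<^sup>+x. ennreal ((x \<bullet> b)\<^sup>2) \<partial>distr std_gaussian borel f)"
    by (simp add: distr_std_gaussian_orthogonal_transformation[OF f(1)])
  also have "\<dots> = (\<integral>\<^sup>+x. ennreal ((f x \<bullet> b)\<^sup>2) \<partial>std_gaussian)"
    by (subst nn_integral_distr) auto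
  also have "\<dots> = (\<integral>\<^sup>+x. ennreal ((norm b)\<^sup>2) * ennreal ((x \<bullet> e)\<^sup>2) \<partial>std_gaussian)"
  proof (intro nn_integral_cong)
    fix x
    have "f x \<bullet> b = norm b * (x \<bullet> e)"
      using f by (metis inner_scaleR_right orthogonal_transformation_def)
    then show "ennreal ((f x \<bullet> b)\<^sup>2) = ennreal ((norm b)\<^sup>2) * ennreal ((x \<bullet> e)\<^sup>2)"
      by (simp add: power_mult_distrib ennreal_mult)
  qed
  also have "\<dots> = ennreal ((norm b)\<^sup>2) * ennreal (1 / 2)"
    by (subst nn_integral_cmult) (auto simp: std_gaussian_second_moment_Basis[OF e])
  finally show ?thesis by (subst (asm) ennreal_mult[symmetric]) auto
qed

lemma std_gaussian_moments:
  fixes b :: "'a::euclidean_space"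
  shows "integrable std_gaussian (\<lambda>x. (x \<bullet> b)\<^sup>2)" "(\<integral>x. (x \<bullet> b)\<^sup>2 \<partial>std_gaussian) = (norm b)\<^sup>2 / 2"
    and "integrable std_gaussian (\<lambda>x. x \<bullet> b)" "(\<integral>x. x \<bullet> b \<partial>std_gaussian) = 0"
proof -
  interpret prob_space "std_gaussian :: 'a measure" by (rule prob_space_std_gaussian)
  show i: "integrable std_gaussian (\<lambda>x. (x \<bullet> b)\<^sup>2)"
    by (rule integrableI_bounded) (auto simp: std_gaussian_second_moment_nn)
  show "(\<integral>x. (x \<bullet> b)\<^sup>2 \<partial>std_gaussian) = (norm b)\<^sup>2 / 2"
    using std_gaussian_second_moment_nn[of b] by (subst (asm) nn_integral_eq_integral) (auto simp: i)
  show "integrable std_gaussian (\<lambda>x. x \<bullet> b)"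
    by (rule square_integrable_imp_integrable[OF _ i]) simp
  have "(\<integral>x. x \<bullet> b \<partial>std_gaussian) = (\<integral>x. x \<bullet> b \<partial>distr std_gaussian borel uminus)"
    using distr_std_gaussian_orthogonal_transformation[of "uminus :: 'a \<Rightarrow> 'a"] orthogonal_transformation_neg[of "\<lambda>x::'a. x"]
    by (simp add: orthogonal_transformation_id)
  also have "\<dots> = - (\<integral>x. x \<bullet> b \<partial>std_gaussian)"
    by (subst integral_distr) auto
  finally show "(\<integral>x. x \<bullet> b \<partial>std_gaussian) = 0" by simp
qed

lemma std_gaussian_norm_square:
  shows "integrable std_gaussian (\<lambda>x::'a::euclidean_space. (norm x)\<^sup>2)"
    and "(\<integral>x. (norm (x::'a))\<^sup>2 \<partial>std_gaussian) = DIM('a) / 2"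
proof -
  have eq: "(norm x)\<^sup>2 = (\<Sum>b\<in>Basis. (x \<bullet> b)\<^sup>2)" for x :: 'a
    unfolding power2_norm_eq_inner by (subst euclidean_inner) (simp add: power2_eq_square)
  show "integrable std_gaussian (\<lambda>x::'a::euclidean_space. (norm x)\<^sup>2)"
    unfolding eq by (intro Bochner_Integration.integrable_sum std_gaussian_moments)
  show "(\<integral>x. (norm (x::'a))\<^sup>2 \<partial>std_gaussian) = DIM('a) / 2"
    unfolding eq by (subst Bochner_Integration.integral_sum) (auto simp: std_gaussian_moments)
qed

subsection \<open>Complex vectors\<close>

text \<open>Conjugate-linear in the first argument, so that \<open>hermitian c\<close> reads off the
  component of \<open>x *s c + w\<close> in the signal direction. Its real part is the inner product
  of \<open>complex ^ 'n\<close> as a real space.\<close>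

definition hermitian :: "complex ^ 'n \<Rightarrow> complex ^ 'n \<Rightarrow> complex" where
  "hermitian c y = (\<Sum>i\<in>UNIV. cnj (c $ i) * y $ i)"

lemma hermitian_add: "hermitian c (y + z) = hermitian c y + hermitian c z"
  by (simp add: hermitian_def algebra_simps sum.distrib)

lemma hermitian_smult: "hermitian c (a *s y) = a * hermitian c y"
  by (simp add: hermitian_def sum_distrib_left mult_ac)

lemma hermitian_scaleR: "hermitian c (a *\<^sub>R y) = a *\<^sub>R hermitian c y"
  by (simp add: hermitian_def scaleR_sum_right)

lemma Re_hermitian: "Re (hermitian c y) = c \<bullet> y"
  by (simp add: hermitian_def inner_vec_def inner_complex_def)

lemma hermitian_self: "hermitian c c = of_real ((norm c)\<^sup>2)"
proof -
  have "(norm c)\<^sup>2 = (\<Sum>i\<in>UNIV. (cmod (c $ i))\<^sup>2)"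
    by (simp add: norm_vec_def L2_set_def sum_nonneg)
  then show ?thesis
    by (simp add: hermitian_def complex_norm_square mult.commute del: of_real_power)
qed

lemma norm_smult: "norm (a *s (y :: complex ^ 'n)) = cmod a * norm y"
  by (simp add: norm_vec_def L2_set_def norm_mult power_mult_distrib sum_distrib_left[symmetric] real_sqrt_mult)

lemma inner_smult: "(a *s c) \<bullet> y = Re (cnj a * hermitian c y)"
  unfolding Re_hermitian[symmetric] by (simp add: hermitian_def sum_distrib_left mult_ac)

lemma norm_add_smult_square:
  fixes y c :: "complex ^ 'n"
  shows "(norm (y + a *s c))\<^sup>2 = (norm y)\<^sup>2 + 2 * Re (cnj a * hermitian c y) + (cmod a)\<^sup>2 * (norm c)\<^sup>2"
proof -
  have "(a *s c) \<bullet> (a *s c) = (cmod a)\<^sup>2 * (norm c)\<^sup>2"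
    by (simp add: power2_norm_eq_inner[symmetric] norm_smult power_mult_distrib)
  then show ?thesis
    unfolding power2_norm_eq_inner[of "y + a *s c"] inner_smult[symmetric]
    by (simp add: inner_add_left inner_add_right inner_commute power2_norm_eq_inner)
qed

lemma continuous_on_smult:
  fixes f :: "'a::topological_space \<Rightarrow> complex"
  assumes "continuous_on S f" "continuous_on S g"
  shows "continuous_on S (\<lambda>x. f x *s (g x :: complex ^ 'n))"
  unfolding vector_scalar_mult_def
  by (intro continuous_on_vec_lambda continuous_intros assms)

lemma borel_measurable_smult[measurable]:
  assumes [measurable]: "f \<in> borel_measurable M" "g \<in> borel_measurable M"
  shows "(\<lambda>x. f x *s (g x :: complex ^ 'n)) \<in> borel_measurable M"
proof -
  have "(\<lambda>z. fst z *s (snd z :: complex ^ 'n)) \<in> borel_measurable borel"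
    by (intro borel_measurable_continuous_onI continuous_on_smult continuous_intros)
  then have "(\<lambda>x. (\<lambda>z. fst z *s (snd z :: complex ^ 'n)) (f x, g x)) \<in> borel_measurable M"
    by (rule measurable_compose[rotated]) (simp add: borel_prod[symmetric])
  then show ?thesis by simp
qed

text \<open>The zero vector receives a direction too, so the degrading map needs no case distinction
  on vanishing channels.\<close>

lemma obtain_unit_vector:
  fixes c :: "complex ^ 'n"
  obtains e where "norm e = 1" "c = norm c *\<^sub>R e"
proof (cases "c = 0")
  case True
  then show thesis using that[of "axis undefined 1"] by simp
next
  case False
  then show thesis using that[of "(1 / norm c) *\<^sub>R c"] by simp
qed

text \<open>
  The noise coordinates along \<open>c\<close> and along \<open>d\<close> are rotated into each other; the new second
  component is standard Gaussian, and contains the signal with gain \<open>norm d\<close>.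
\<close>

lemma obtain_degrading_map:
  fixes c :: "complex ^ 'b" and d :: "complex ^ 'e"
  assumes "norm d \<le> norm c"
  obtains F :: "(complex ^ 'b) \<times> (complex ^ 'e) \<Rightarrow> complex ^ 'e" where "F \<in> borel_measurable borel"
    "\<And>x w v. F (x *s c + w, v) = x *s d + F (w, v)" "distr std_gaussian borel F = std_gaussian"
proof -
  obtain e where e: "norm e = 1" "c = norm c *\<^sub>R e" by (rule obtain_unit_vector)
  obtain f where f: "norm f = 1" "d = norm d *\<^sub>R f" by (rule obtain_unit_vector)
  \<comment> \<open>The loss of amplitude from \<open>c\<close> to \<open>d\<close>. If
    \<open>c = 0\<close> then \<open>d = 0\<close>, and division by zero gives
    \<open>\<rho> = 0\<close>, so that \<open>\<rho> * norm c = norm d\<close> holds in this case as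
    well.\<close>
  define \<rho> where "\<rho> = norm d / norm c"
  have \<rho>: "0 \<le> \<rho>" "\<rho> \<le> 1" "\<rho> * norm c = norm d"
    using assms by (auto simp: \<rho>_def divide_le_eq)
  define \<sigma> where "\<sigma> = sqrt (1 - \<rho>\<^sup>2)"
  have \<sigma>: "\<rho>\<^sup>2 + \<sigma>\<^sup>2 = 1"
    using \<rho> by (simp add: \<sigma>_def power_le_one)
  \<comment> \<open>With \<open>a\<close> the coordinate along \<open>e\<close> and \<open>b\<close>
    the one along \<open>f\<close>, this is the rotation of \<open>(a, b)\<close> to
    \<open>(\<sigma> * a - \<rho> * b, \<rho> * a + \<sigma> * b)\<close>, and the identity on the
    orthogonal complement. It is written as a correction of the identity, whence
    \<open>\<sigma> - 1\<close>.\<close>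
  define T where "T p = (fst p + (of_real (\<sigma> - 1) * hermitian e (fst p) - of_real \<rho> * hermitian f (snd p)) *s e,
     snd p + (of_real \<rho> * hermitian e (fst p) + of_real (\<sigma> - 1) * hermitian f (snd p)) *s f)" for p
  have lin: "linear T"
  proof (rule linearI)
    show "T (p + q) = T p + T q" for p q
      by (simp add: T_def hermitian_add vec_eq_iff algebra_simps)
    show "T (r *\<^sub>R p) = r *\<^sub>R T p" for r p
      by (simp add: T_def hermitian_scaleR vec_eq_iff algebra_simps)
  qed
  have nrm: "norm (T p) = norm p" for p
  proof -
    define a b where "a = hermitian e (fst p)" "b = hermitian f (snd p)"
    define r s where "r = of_real (\<sigma> - 1) * a - of_real \<rho> * b" "s = of_real \<rho> * a + of_real (\<sigma> - 1) * b"
    have "(norm (T p))\<^sup>2 = (norm (fst p + r *s e))\<^sup>2 + (norm (snd p + s *s f))\<^sup>2"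
      by (simp add: T_def norm_prod_def a_b_def r_s_def)
    also have "\<dots> = (norm p)\<^sup>2 + (2 * Re (cnj r * a) + (cmod r)\<^sup>2 + 2 * Re (cnj s * b) + (cmod s)\<^sup>2)"
      by (simp add: norm_add_smult_square e(1) f(1) norm_prod_def flip: a_b_def)
    also have "2 * Re (cnj r * a) + (cmod r)\<^sup>2 + 2 * Re (cnj s * b) + (cmod s)\<^sup>2 =
       (\<rho>\<^sup>2 + \<sigma>\<^sup>2 - 1) * ((cmod a)\<^sup>2 + (cmod b)\<^sup>2)"
      by (simp add: r_s_def cmod_power2) (simp add: power2_eq_square algebra_simps)
    finally show ?thesis using \<sigma> by simp
  qed
  have orth: "orthogonal_transformation T"
    using lin nrm by (simp add: orthogonal_transformation)
  have [measurable]: "T \<in> borel_measurable borel"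
    using lin by (rule borel_measurable_linear)
  have m2: "snd \<in> borel_measurable (borel :: ((complex ^ 'b) \<times> (complex ^ 'e)) measure)"
    by (intro borel_measurable_continuous_onI continuous_intros)
  show thesis
  proof (rule that[of "\<lambda>p. snd (T p)"])
    show "(\<lambda>p. snd (T p)) \<in> borel_measurable borel"
      by (rule measurable_compose[OF _ m2]) measurable
    have h: "hermitian e (x *s c) = x * of_real (norm c)" for x
      by (subst e(2)) (simp add: hermitian_smult hermitian_scaleR hermitian_self e(1) scaleR_conv_of_real[where 'a = complex])
    have df: "(x * of_real (norm d)) *s f = x *s d" for x
      by (subst (2) f(2)) (simp add: vec_eq_iff scaleR_conv_of_real[where 'a = complex])
    have rn: "complex_of_real \<rho> * (x * of_real (norm c)) = x * of_real (norm d)" for x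
      using \<rho>(3) by (metis mult.left_commute of_real_mult)
    \<comment> \<open>This is the second component of \<open>T (x *s c, 0)\<close>; by linearity the
      signal leaves the map as \<open>x *s d\<close>.\<close>
    have "(of_real \<rho> * hermitian e (x *s c)) *s f = x *s d" for x
      by (simp only: h rn df)
    then show "snd (T (x *s c + w, v)) = x *s d + snd (T (w, v))" for x w v
      by (simp add: T_def hermitian_add ring_distribs vec.scale_left_distrib)
    have "distr std_gaussian borel (\<lambda>p. snd (T p)) = distr (distr std_gaussian borel T) borel snd"
      by (subst distr_distr) (auto simp: comp_def m2)
    also have "\<dots> = distr ((std_gaussian :: (complex ^ 'b) measure) \<Otimes>\<^sub>M (std_gaussian :: (complex ^ 'e) measure)) borel snd"
      by (simp add: distr_std_gaussian_orthogonal_transformation[OF orth] std_gaussian_pair)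
    also have "\<dots> = distr ((std_gaussian :: (complex ^ 'b) measure) \<Otimes>\<^sub>M (std_gaussian :: (complex ^ 'e) measure)) std_gaussian snd"
      by (rule distr_cong) auto
    also have "\<dots> = std_gaussian"
      by (intro distr_pair_snd prob_space_std_gaussian prob_space_imp_sigma_finite)
    finally show "distr std_gaussian borel (\<lambda>p. snd (T p)) = std_gaussian" .
  qed
qed

subsection \<open>The channel law\<close>

definition noise_density :: "complex ^ 'n \<Rightarrow> real" where
  "noise_density w = exp (- (norm w)\<^sup>2) / pi ^ CARD('n)"

lemma noise_density_pos: "0 < noise_density w"
  by (simp add: noise_density_def)

lemma borel_measurable_noise_density[measurable]: "noise_density \<in> borel_measurable borel"
  unfolding noise_density_def[abs_def] by measurable

lemma std_gaussian_noise_density: "std_gaussian = density lborel (\<lambda>w. ennreal (noise_density w))"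
  unfolding complex_gaussian_noise_eq[symmetric] complex_gaussian_noise_def noise_density_def ..

text \<open>The input \<open>x\<close> is kept beside the message and the output, since
  \<open>I(x; y | u)\<close> involves all three.\<close>

definition joint_law :: "('u \<times> complex) measure \<Rightarrow> complex ^ 'n \<Rightarrow> (('u \<times> complex) \<times> (complex ^ 'n)) measure" where
  "joint_law p c = distr (p \<Otimes>\<^sub>M std_gaussian) (p \<Otimes>\<^sub>M borel) (\<lambda>(v, w). (v, snd v *s c + w))"

definition output_law :: "('u \<times> complex) measure \<Rightarrow> complex ^ 'n \<Rightarrow> (complex ^ 'n) measure" where
  "output_law p c = distr (joint_law p c) borel snd"

text \<open>The noise density averaged over the transmitted signal. A real-valued integral is
  adequate because the noise density is bounded by \<open>1\<close>.\<close>

definition output_density :: "('u \<times> complex) measure \<Rightarrow> complex ^ 'n \<Rightarrow> complex ^ 'n \<Rightarrow> real" where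
  "output_density p c y = (\<integral>v. noise_density (y - snd v *s c) \<partial>p)"

locale input_law = prob_space p for p :: "('u \<times> complex) measure" +
  fixes U :: "'u measure"
  assumes sets_p[measurable_cong]: "sets p = sets (U \<Otimes>\<^sub>M borel)"
begin

lemma measurable_message[measurable]: "fst \<in> p \<rightarrow>\<^sub>M U"
  using measurable_cong_sets[OF sets_p refl, of U] by simp

lemma sets_joint_law[measurable_cong]: "sets (joint_law p c) = sets (p \<Otimes>\<^sub>M borel)"
  by (simp add: joint_law_def)

lemma prob_space_joint_law:
  fixes c :: "complex ^ 'n"
  shows "prob_space (joint_law p c)"
proof -
  interpret pair_prob_space p "std_gaussian :: (complex ^ 'n) measure"
    by (intro pair_prob_space.intro pair_sigma_finite.intro prob_space_axioms prob_space_std_gaussian prob_space_imp_sigma_finite)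
  show ?thesis unfolding joint_law_def
    by (rule prob_space_distr) measurable
qed

lemma nn_integral_joint_law:
  fixes c :: "complex ^ 'n"
  assumes [measurable]: "h \<in> borel_measurable (p \<Otimes>\<^sub>M borel)"
  shows "(\<integral>\<^sup>+z. h z \<partial>joint_law p c) = (\<integral>\<^sup>+v. \<integral>\<^sup>+w. h (v, snd v *s c + w) \<partial>std_gaussian \<partial>p)"
proof -
  interpret N: sigma_finite_measure "std_gaussian :: (complex ^ 'n) measure"
    by (intro prob_space_std_gaussian prob_space_imp_sigma_finite)
  have "(\<integral>\<^sup>+z. h z \<partial>joint_law p c) = (\<integral>\<^sup>+z. h (fst z, snd (fst z) *s c + snd z) \<partial>(p \<Otimes>\<^sub>M std_gaussian))"
    unfolding joint_law_def by (subst nn_integral_distr) (auto simp: case_prod_unfold)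
  also have "\<dots> = (\<integral>\<^sup>+v. \<integral>\<^sup>+w. h (v, snd v *s c + w) \<partial>std_gaussian \<partial>p)"
    by (subst N.nn_integral_fst[symmetric]) auto
  finally show ?thesis .
qed

lemma nn_integral_joint_law_density:
  fixes c :: "complex ^ 'n"
  assumes [measurable]: "h \<in> borel_measurable (p \<Otimes>\<^sub>M borel)"
  shows "(\<integral>\<^sup>+z. h z \<partial>joint_law p c) = (\<integral>\<^sup>+v. \<integral>\<^sup>+y. ennreal (noise_density (y - snd v *s c)) * h (v, y) \<partial>lborel \<partial>p)"
  unfolding nn_integral_joint_law[OF assms]
proof (rule nn_integral_cong)
  fix v assume [measurable]: "v \<in> space p"
  have "(\<integral>\<^sup>+w. h (v, snd v *s c + w) \<partial>std_gaussian) = (\<integral>\<^sup>+w. ennreal (noise_density w) * h (v, snd v *s c + w) \<partial>lborel)"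
    unfolding std_gaussian_noise_density by (subst nn_integral_density) auto
  also have "\<dots> = (\<integral>\<^sup>+w. (\<lambda>y. ennreal (noise_density (y - snd v *s c)) * h (v, y)) (w + snd v *s c) \<partial>lborel)"
    by (simp add: add.commute)
  also have "\<dots> = (\<integral>\<^sup>+y. ennreal (noise_density (y - snd v *s c)) * h (v, y) \<partial>lborel)"
    by (rule nn_integral_lborel_translate) measurable
  finally show "(\<integral>\<^sup>+w. h (v, snd v *s c + w) \<partial>std_gaussian) = \<dots>" .
qed

text \<open>Positivity of \<open>q\<close> allows division by it. The lemma serves two choices of
  \<open>q\<close>: the output density of the input itself, and that of the reference input.\<close>

lemma joint_law_eq_density:
  fixes c :: "complex ^ 'n"
  assumes [measurable]: "q \<in> borel_measurable borel" and q: "\<And>y. 0 < q y"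
    and sf: "sigma_finite_measure (density lborel (\<lambda>y. ennreal (q y)))"
  shows "joint_law p c = density (p \<Otimes>\<^sub>M density lborel (\<lambda>y. ennreal (q y)))
    (\<lambda>(v, y). ennreal (noise_density (y - snd v *s c) / q y))"
proof (rule measure_eqI_nn_integral)
  interpret R: sigma_finite_measure "density lborel (\<lambda>y. ennreal (q y))" by fact
  have sets_R[measurable_cong]: "sets (p \<Otimes>\<^sub>M density lborel (\<lambda>y. ennreal (q y))) = sets (p \<Otimes>\<^sub>M borel)"
    by (rule sets_pair_measure_cong) auto
  show "sets (joint_law p c) = sets (density (p \<Otimes>\<^sub>M density lborel (\<lambda>y. ennreal (q y)))
    (\<lambda>(v, y). ennreal (noise_density (y - snd v *s c) / q y)))"
    by (simp add: sets_joint_law sets_R)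
  fix h :: "('u \<times> complex) \<times> (complex ^ 'n) \<Rightarrow> ennreal" assume "h \<in> borel_measurable (joint_law p c)"
  then have [measurable]: "h \<in> borel_measurable (p \<Otimes>\<^sub>M borel)"
    by (simp add: measurable_cong_sets[OF sets_joint_law refl])
  have "(\<integral>\<^sup>+z. h z \<partial>density (p \<Otimes>\<^sub>M density lborel (\<lambda>y. ennreal (q y))) (\<lambda>(v, y). ennreal (noise_density (y - snd v *s c) / q y)))
    = (\<integral>\<^sup>+z. ennreal (noise_density (snd z - snd (fst z) *s c) / q (snd z)) * h z \<partial>(p \<Otimes>\<^sub>M density lborel (\<lambda>y. ennreal (q y))))"
    by (subst nn_integral_density) (auto simp: case_prod_unfold)
  also have "\<dots> = (\<integral>\<^sup>+v. \<integral>\<^sup>+y. ennreal (noise_density (y - snd v *s c) / q y) * h (v, y) \<partial>density lborel (\<lambda>y. ennreal (q y)) \<partial>p)"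
    by (subst R.nn_integral_fst[symmetric]) auto
  also have "\<dots> = (\<integral>\<^sup>+v. \<integral>\<^sup>+y. ennreal (noise_density (y - snd v *s c)) * h (v, y) \<partial>lborel \<partial>p)"
  proof (rule nn_integral_cong)
    fix v assume [measurable]: "v \<in> space p"
    have "(\<integral>\<^sup>+y. ennreal (noise_density (y - snd v *s c) / q y) * h (v, y) \<partial>density lborel (\<lambda>y. ennreal (q y)))
      = (\<integral>\<^sup>+y. ennreal (q y) * (ennreal (noise_density (y - snd v *s c) / q y) * h (v, y)) \<partial>lborel)"
      by (subst nn_integral_density) auto
    also have "\<dots> = (\<integral>\<^sup>+y. ennreal (noise_density (y - snd v *s c)) * h (v, y) \<partial>lborel)"
    proof (rule nn_integral_cong)
      fix y
      have "ennreal (q y) * ennreal (noise_density (y - snd v *s c) / q y) = ennreal (noise_density (y - snd v *s c))"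
        using q[of y] by (subst ennreal_mult'[symmetric]) auto
      then show "ennreal (q y) * (ennreal (noise_density (y - snd v *s c) / q y) * h (v, y)) = ennreal (noise_density (y - snd v *s c)) * h (v, y)"
        by (simp only: mult.assoc[symmetric])
    qed
    finally show "(\<integral>\<^sup>+y. ennreal (noise_density (y - snd v *s c) / q y) * h (v, y) \<partial>density lborel (\<lambda>y. ennreal (q y))) = \<dots>" .
  qed
  also have "\<dots> = (\<integral>\<^sup>+z. h z \<partial>joint_law p c)"
    by (rule nn_integral_joint_law_density[symmetric]) measurable
  finally show "(\<integral>\<^sup>+z. h z \<partial>joint_law p c) = (\<integral>\<^sup>+z. h z \<partial>density (p \<Otimes>\<^sub>M density lborel (\<lambda>y. ennreal (q y))) (\<lambda>(v, y). ennreal (noise_density (y - snd v *s c) / q y)))" ..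
qed

lemma integrable_noise_density:
  fixes c :: "complex ^ 'n"
  shows "integrable p (\<lambda>v. noise_density (y - snd v *s c))"
proof (rule integrable_const_bound)
  show "AE v in p. norm (noise_density (y - snd v *s c)) \<le> 1"
  proof (rule AE_I2)
    fix v
    have "1 \<le> pi ^ CARD('n)" using pi_ge_two by (intro one_le_power) simp
    then show "norm (noise_density (y - snd v *s c)) \<le> 1"
      by (simp add: noise_density_def divide_le_eq order.trans[of _ 1])
  qed
qed measurable

lemma output_density_pos: "0 < output_density p c y"
proof -
  have "0 \<le> output_density p c y"
    unfolding output_density_def by (intro Bochner_Integration.integral_nonneg) (simp add: less_imp_le noise_density_pos)
  moreover have "output_density p c y \<noteq> 0"
  proof
    assume "output_density p c y = 0"
    then have "AE v in p. noise_density (y - snd v *s c) = 0"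
      unfolding output_density_def
      by (subst (asm) integral_nonneg_eq_0_iff_AE) (auto simp: integrable_noise_density less_imp_le noise_density_pos)
    then have "AE v in p. False" by eventually_elim (metis less_irrefl noise_density_pos)
    then show False by simp
  qed
  ultimately show ?thesis by simp
qed

lemma borel_measurable_output_density[measurable]: "output_density p c \<in> borel_measurable borel"
  unfolding output_density_def[abs_def] by measurable

lemma output_law_eq_density:
  fixes c :: "complex ^ 'n"
  shows "output_law p c = density lborel (\<lambda>y. ennreal (output_density p c y))"
proof (rule measure_eqI_nn_integral)
  show "sets (output_law p c) = sets (density lborel (\<lambda>y. ennreal (output_density p c y)))"
    by (simp add: output_law_def)
  fix h :: "complex ^ 'n \<Rightarrow> ennreal" assume "h \<in> borel_measurable (output_law p c)"
  then have [measurable]: "h \<in> borel_measurable borel"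
    by (simp add: output_law_def)
  interpret PL: pair_sigma_finite p "lborel :: (complex ^ 'n) measure"
    by (intro pair_sigma_finite.intro sigma_finite_measure_axioms sigma_finite_lborel)
  have "(\<integral>\<^sup>+y. h y \<partial>output_law p c) = (\<integral>\<^sup>+z. h (snd z) \<partial>joint_law p c)"
    unfolding output_law_def by (subst nn_integral_distr) auto
  also have "\<dots> = (\<integral>\<^sup>+v. \<integral>\<^sup>+y. ennreal (noise_density (y - snd v *s c)) * h y \<partial>lborel \<partial>p)"
    by (subst nn_integral_joint_law_density) auto
  also have "\<dots> = (\<integral>\<^sup>+y. \<integral>\<^sup>+v. ennreal (noise_density (y - snd v *s c)) * h y \<partial>p \<partial>lborel)"
    by (rule PL.Fubini'[symmetric]) measurable
  also have "\<dots> = (\<integral>\<^sup>+y. ennreal (output_density p c y) * h y \<partial>lborel)"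
  proof (rule nn_integral_cong)
    fix y
    have "(\<integral>\<^sup>+v. ennreal (noise_density (y - snd v *s c)) * h y \<partial>p) = (\<integral>\<^sup>+v. ennreal (noise_density (y - snd v *s c)) \<partial>p) * h y"
      by (rule nn_integral_multc) measurable
    also have "(\<integral>\<^sup>+v. ennreal (noise_density (y - snd v *s c)) \<partial>p) = ennreal (output_density p c y)"
      unfolding output_density_def
      by (rule nn_integral_eq_integral) (auto simp: integrable_noise_density less_imp_le noise_density_pos)
    finally show "(\<integral>\<^sup>+v. ennreal (noise_density (y - snd v *s c)) * h y \<partial>p) = ennreal (output_density p c y) * h y" .
  qed
  also have "\<dots> = (\<integral>\<^sup>+y. h y \<partial>density lborel (\<lambda>y. ennreal (output_density p c y)))"
    by (subst nn_integral_density) auto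
  finally show "(\<integral>\<^sup>+y. h y \<partial>output_law p c) = (\<integral>\<^sup>+y. h y \<partial>density lborel (\<lambda>y. ennreal (output_density p c y)))" .
qed

lemma prob_space_output_law: "prob_space (output_law p c)"
  unfolding output_law_def by (rule prob_space.prob_space_distr[OF prob_space_joint_law]) measurable

lemma sets_output_law[measurable_cong, simp]: "sets (output_law p c) = sets borel"
  by (simp add: output_law_def)

lemma joint_law_eq_density_output:
  "joint_law p c = density (p \<Otimes>\<^sub>M output_law p c) (\<lambda>(v, y). ennreal (noise_density (y - snd v *s c) / output_density p c y))"
  unfolding output_law_eq_density
  using prob_space_output_law[of c, THEN prob_space_imp_sigma_finite]
  by (intro joint_law_eq_density output_density_pos) (auto simp: output_law_eq_density)

text \<open>For fixed \<open>(u, x)\<close>, the map \<open>F\<close> turns the output of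
  \<open>c\<close> and fresh noise into \<open>x *s d\<close> plus \<open>F\<close> of pure noise,
  which is again standard Gaussian. The pair \<open>(u, x)\<close> is untouched, so the statements
  about messages and outputs follow by choosing an \<open>h\<close> that ignores some
  components.\<close>

lemma nn_integral_degraded:
  fixes c :: "complex ^ 'b" and d :: "complex ^ 'e" and F :: "(complex ^ 'b) \<times> (complex ^ 'e) \<Rightarrow> complex ^ 'e"
  assumes F: "F \<in> borel_measurable borel"
    and shift: "\<And>x w v. F (x *s c + w, v) = x *s d + F (w, v)"
    and law: "distr std_gaussian borel F = std_gaussian"
    and [measurable]: "h \<in> borel_measurable (p \<Otimes>\<^sub>M borel)"
  shows "(\<integral>\<^sup>+z. \<integral>\<^sup>+w. h (fst z, F (snd z, w)) \<partial>std_gaussian \<partial>joint_law p c) = (\<integral>\<^sup>+z. h z \<partial>joint_law p d)"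
proof -
  interpret N: sigma_finite_measure "std_gaussian :: (complex ^ 'b) measure"
    by (intro prob_space_std_gaussian prob_space_imp_sigma_finite)
  interpret N': sigma_finite_measure "std_gaussian :: (complex ^ 'e) measure"
    by (intro prob_space_std_gaussian prob_space_imp_sigma_finite)
  have [measurable]: "F \<in> borel \<Otimes>\<^sub>M borel \<rightarrow>\<^sub>M borel"
    using F by (simp add: borel_prod)
  have "(\<integral>\<^sup>+z. \<integral>\<^sup>+w. h (fst z, F (snd z, w)) \<partial>std_gaussian \<partial>joint_law p c)
    = (\<integral>\<^sup>+v. \<integral>\<^sup>+w. \<integral>\<^sup>+w'. h (v, F (snd v *s c + w, w')) \<partial>std_gaussian \<partial>std_gaussian \<partial>p)"
    by (subst nn_integral_joint_law) auto
  also have "\<dots> = (\<integral>\<^sup>+v. \<integral>\<^sup>+w. h (v, snd v *s d + w) \<partial>std_gaussian \<partial>p)"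
  proof (rule nn_integral_cong)
    fix v assume [measurable]: "v \<in> space p"
    have "(\<integral>\<^sup>+w. h (v, snd v *s d + w) \<partial>std_gaussian) = (\<integral>\<^sup>+w. h (v, snd v *s d + w) \<partial>distr std_gaussian borel F)"
      unfolding law ..
    also have "\<dots> = (\<integral>\<^sup>+z. h (v, snd v *s d + F z) \<partial>std_gaussian)"
      by (subst nn_integral_distr) (auto simp: F measurable_cong_sets[OF sets_std_gaussian refl])
    also have "\<dots> = (\<integral>\<^sup>+z. h (v, snd v *s d + F z) \<partial>(std_gaussian \<Otimes>\<^sub>M std_gaussian))"
      unfolding std_gaussian_pair ..
    also have "\<dots> = (\<integral>\<^sup>+w. \<integral>\<^sup>+w'. h (v, F (snd v *s c + w, w')) \<partial>std_gaussian \<partial>std_gaussian)"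
      unfolding shift by (rule N'.nn_integral_fst[symmetric]) measurable
    finally show "(\<integral>\<^sup>+w. \<integral>\<^sup>+w'. h (v, F (snd v *s c + w, w')) \<partial>std_gaussian \<partial>std_gaussian) = (\<integral>\<^sup>+w. h (v, snd v *s d + w) \<partial>std_gaussian)" ..
  qed
  also have "\<dots> = (\<integral>\<^sup>+z. h z \<partial>joint_law p d)"
    by (rule nn_integral_joint_law[symmetric]) measurable
  finally show ?thesis .
qed

end

section \<open>The message, and conditional independence given the message\<close>

context input_law
begin

definition message_law :: "'u measure" where
  "message_law = distr p U fst"

definition message_output_law :: "complex ^ 'n \<Rightarrow> ('u \<times> (complex ^ 'n)) measure" where
  "message_output_law c = distr (joint_law p c) (U \<Otimes>\<^sub>M borel) (\<lambda>(v, y). (fst v, y))"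

text \<open>The law of \<open>((u, x), y)\<close> under which \<open>x\<close> and \<open>y\<close> are conditionally independent given \<open>u\<close>.\<close>

definition cond_indep_law :: "complex ^ 'n \<Rightarrow> (('u \<times> complex) \<times> (complex ^ 'n)) measure" where
  "cond_indep_law c = density (p \<Otimes>\<^sub>M output_law p c)
     (\<lambda>(v, y). RN_deriv (message_law \<Otimes>\<^sub>M output_law p c) (message_output_law c) (fst v, y))"

lemma prob_space_message_law: "prob_space message_law"
  unfolding message_law_def by (rule prob_space_distr) measurable

lemma sets_message_law[measurable_cong, simp]: "sets message_law = sets U"
  by (simp add: message_law_def)

lemma sets_message_output_law[measurable_cong, simp]: "sets (message_output_law c) = sets (U \<Otimes>\<^sub>M borel)"
  by (simp add: message_output_law_def)

lemma prob_space_message_output_law: "prob_space (message_output_law c)"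
  unfolding message_output_law_def by (rule prob_space.prob_space_distr[OF prob_space_joint_law]) measurable

lemma sets_message_pair: "sets (message_law \<Otimes>\<^sub>M output_law p c) = sets (U \<Otimes>\<^sub>M borel)"
  by (rule sets_pair_measure_cong) simp_all

lemma sets_input_pair: "sets (p \<Otimes>\<^sub>M output_law p c) = sets (p \<Otimes>\<^sub>M borel)"
  by (rule sets_pair_measure_cong) simp_all

lemma prob_space_message_pair: "prob_space (message_law \<Otimes>\<^sub>M output_law p c)"
  by (intro prob_space_pair prob_space_message_law prob_space_output_law)

lemma prob_space_input_pair: "prob_space (p \<Otimes>\<^sub>M output_law p c)"
  by (intro prob_space_pair prob_space_axioms prob_space_output_law)

text \<open>Presents the product as an image under the map that also defines
  \<open>message_output_law\<close>. Forgetting \<open>x\<close> thereby becomes a processing step,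
  along which absolute continuity, almost sure statements and divergences can be carried.\<close>

lemma message_pair_eq:
  "message_law \<Otimes>\<^sub>M output_law p c = distr (p \<Otimes>\<^sub>M output_law p c) (U \<Otimes>\<^sub>M borel) (\<lambda>(v, y). (fst v, y))"
proof -
  have "output_law p c = distr (output_law p c) borel (\<lambda>y. y)"
    by (rule distr_id2[symmetric]) simp
  moreover have "distr p U fst \<Otimes>\<^sub>M distr (output_law p c) borel (\<lambda>y. y) = distr (p \<Otimes>\<^sub>M output_law p c) (U \<Otimes>\<^sub>M borel) (\<lambda>(v, y). (fst v, y))"
  proof (rule pair_measure_distr)
    show "sigma_finite_measure (distr (output_law p c) borel (\<lambda>y. y))"
      by (intro prob_space_imp_sigma_finite prob_space.prob_space_distr prob_space_output_law) simp
  qed measurable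
  ultimately show ?thesis by (simp add: message_law_def)
qed

lemma ac_joint: "absolutely_continuous (p \<Otimes>\<^sub>M output_law p c) (joint_law p c)"
  by (subst joint_law_eq_density_output, rule absolutely_continuousI_density) measurable

lemma ac_message: "absolutely_continuous (message_law \<Otimes>\<^sub>M output_law p c) (message_output_law c)"
  unfolding message_pair_eq message_output_law_def
  by (rule absolutely_continuous_distr[OF ac_joint]) (simp_all add: sets_joint_law sets_input_pair)

text \<open>Integrating over \<open>joint_law\<close> instead of \<open>output_law\<close> makes
  \<open>nn_integral_degraded\<close> applicable for each fixed message.\<close>

lemma nn_integral_message_pair:
  fixes c :: "complex ^ 'n"
  assumes [measurable]: "h \<in> borel_measurable (U \<Otimes>\<^sub>M borel)"
  shows "(\<integral>\<^sup>+z. h z \<partial>(message_law \<Otimes>\<^sub>M output_law p c)) = (\<integral>\<^sup>+u. \<integral>\<^sup>+z. h (u, snd z) \<partial>joint_law p c \<partial>message_law)"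
proof -
  interpret O: sigma_finite_measure "output_law p c" by (intro prob_space_imp_sigma_finite prob_space_output_law)
  have "(\<integral>\<^sup>+z. h z \<partial>(message_law \<Otimes>\<^sub>M output_law p c)) = (\<integral>\<^sup>+u. \<integral>\<^sup>+y. h (u, y) \<partial>output_law p c \<partial>message_law)"
    by (rule O.nn_integral_fst[symmetric]) measurable
  also have "\<dots> = (\<integral>\<^sup>+u. \<integral>\<^sup>+z. h (u, snd z) \<partial>joint_law p c \<partial>message_law)"
  proof (rule nn_integral_cong)
    fix u assume "u \<in> space message_law"
    then have [measurable]: "u \<in> space U" by (simp add: message_law_def)
    show "(\<integral>\<^sup>+y. h (u, y) \<partial>output_law p c) = (\<integral>\<^sup>+z. h (u, snd z) \<partial>joint_law p c)"
      unfolding output_law_def by (subst nn_integral_distr) auto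
  qed
  finally show ?thesis .
qed

text \<open>One real function \<open>r\<close> serves as the density of
  \<open>message_output_law\<close> and inside \<open>cond_indep_law\<close>. It agrees with the
  Radon-Nikodym derivative almost everywhere on messages and outputs, and
  \<open>message_pair_eq\<close> pulls this back to inputs and outputs.\<close>

lemma real_density_message:
  fixes c :: "complex ^ 'n"
  obtains r :: "'u \<times> (complex ^ 'n) \<Rightarrow> real" where "r \<in> borel_measurable (U \<Otimes>\<^sub>M borel)" "\<And>z. 0 \<le> r z"
    "message_output_law c = density (message_law \<Otimes>\<^sub>M output_law p c) (\<lambda>z. ennreal (r z))"
    "cond_indep_law c = density (p \<Otimes>\<^sub>M output_law p c) (\<lambda>(v, y). ennreal (r (fst v, y)))"
    "AE z in p \<Otimes>\<^sub>M output_law p c. 0 < r (fst (fst z), snd z)"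
proof -
  let ?Q = "message_law \<Otimes>\<^sub>M output_law p c"
  let ?T = "\<lambda>(v :: 'u \<times> complex, y :: complex ^ 'n). (fst v, y)"
  have [measurable]: "?T \<in> p \<Otimes>\<^sub>M output_law p c \<rightarrow>\<^sub>M U \<Otimes>\<^sub>M borel"
    by measurable
  then have TQ: "?T \<in> p \<Otimes>\<^sub>M output_law p c \<rightarrow>\<^sub>M ?Q"
    using measurable_cong_sets[OF refl sets_message_pair] by blast
  have [measurable]: "?T \<in> joint_law p c \<rightarrow>\<^sub>M U \<Otimes>\<^sub>M borel"
    by measurable
  obtain r :: "'u \<times> (complex ^ 'n) \<Rightarrow> real" where r: "r \<in> borel_measurable ?Q" and r0: "\<And>z. 0 \<le> r z"
    and M: "message_output_law c = density ?Q (\<lambda>z. ennreal (r z))" and rpos: "AE z in message_output_law c. 0 < r z"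
    using obtain_real_density[OF prob_space_message_pair prob_space_message_output_law _ ac_message]
    by (metis sets_message_output_law sets_message_pair)
  have rm[measurable]: "r \<in> borel_measurable (U \<Otimes>\<^sub>M borel)"
    using r by (simp add: measurable_cong_sets[OF sets_message_pair refl])
  interpret Q: prob_space ?Q by (rule prob_space_message_pair)
  have "AE z in ?Q. ennreal (r z) = RN_deriv ?Q (message_output_law c) z"
    unfolding M using r by (intro Q.RN_deriv_unique) auto
  then have "AE z in distr (p \<Otimes>\<^sub>M output_law p c) (U \<Otimes>\<^sub>M borel) ?T. ennreal (r z) = RN_deriv ?Q (message_output_law c) z"
    unfolding message_pair_eq .
  then have "AE z in p \<Otimes>\<^sub>M output_law p c. ennreal (r (?T z)) = RN_deriv ?Q (message_output_law c) (?T z)"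
    by (rule AE_distrD[rotated]) measurable
  then have "cond_indep_law c = density (p \<Otimes>\<^sub>M output_law p c) (\<lambda>(v, y). ennreal (r (fst v, y)))"
    unfolding cond_indep_law_def
  proof (intro density_cong)
    show "(\<lambda>(v, y). RN_deriv ?Q (message_output_law c) (fst v, y)) \<in> borel_measurable (p \<Otimes>\<^sub>M output_law p c)"
      using measurable_compose[OF TQ borel_measurable_RN_deriv] by (simp add: case_prod_unfold)
  qed (auto simp: case_prod_unfold)
  moreover have "AE z in p \<Otimes>\<^sub>M output_law p c. 0 < r (fst (fst z), snd z)"
  proof -
    have "AE z in joint_law p c. 0 < r (?T z)"
      using rpos unfolding message_output_law_def by (rule AE_distrD[rotated]) measurable
    \<comment> \<open>The density of the joint law relative to the product is strictly positive, so
      positivity of \<open>r\<close> passes from the joint law back to the product.\<close>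
    then have "AE z in p \<Otimes>\<^sub>M output_law p c. 0 < ennreal (noise_density (snd z - snd (fst z) *s c) / output_density p c (snd z)) \<longrightarrow> 0 < r (?T z)"
      by (subst (asm) joint_law_eq_density_output, subst (asm) AE_density) (auto simp: case_prod_unfold)
    then show ?thesis
      by eventually_elim (auto simp: case_prod_unfold noise_density_pos output_density_pos)
  qed
  ultimately show thesis using that[OF rm r0 M] by blast
qed

end

context input_law
begin

text \<open>The density depends on \<open>(u, x)\<close> only through \<open>u\<close>, so its
  integral is that of \<open>r\<close> over messages and outputs, which is the mass of
  \<open>message_output_law\<close>.\<close>

lemma prob_space_cond_indep_law:
  fixes c :: "complex ^ 'n"
  shows "prob_space (cond_indep_law c)"
proof -
  obtain r where r[measurable]: "r \<in> borel_measurable (U \<Otimes>\<^sub>M borel)" and r0: "\<And>z. 0 \<le> r z"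
    and M: "message_output_law c = density (message_law \<Otimes>\<^sub>M output_law p c) (\<lambda>z. ennreal (r z))"
    and C: "cond_indep_law c = density (p \<Otimes>\<^sub>M output_law p c) (\<lambda>(v, y). ennreal (r (fst v, y)))"
    and "AE z in p \<Otimes>\<^sub>M output_law p c. 0 < r (fst (fst z), snd z)"
    using real_density_message[of c] by blast
  let ?T = "\<lambda>(v :: 'u \<times> complex, y :: (complex ^ 'n)). (fst v, y)"
  have [measurable]: "?T \<in> p \<Otimes>\<^sub>M output_law p c \<rightarrow>\<^sub>M U \<Otimes>\<^sub>M borel"
    by measurable
  have "emeasure (cond_indep_law c) (space (cond_indep_law c)) = (\<integral>\<^sup>+z. ennreal (r (?T z)) \<partial>(p \<Otimes>\<^sub>M output_law p c))"
    unfolding C space_density by (subst emeasure_density[OF _ sets.top]) (auto simp: case_prod_unfold intro!: nn_integral_cong)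
  also have "\<dots> = (\<integral>\<^sup>+z. ennreal (r z) \<partial>(message_law \<Otimes>\<^sub>M output_law p c))"
    unfolding message_pair_eq by (subst nn_integral_distr) auto
  also have "\<dots> = emeasure (message_output_law c) (space (message_output_law c))"
    unfolding M space_density using r
    by (subst emeasure_density[OF _ sets.top]) (auto simp: measurable_cong_sets[OF sets_message_pair refl] intro!: nn_integral_cong)
  also have "\<dots> = 1" by (rule prob_space.emeasure_space_1[OF prob_space_message_output_law])
  finally show ?thesis by (rule prob_spaceI)
qed

lemma sets_cond_indep_law[measurable_cong]: "sets (cond_indep_law c) = sets (p \<Otimes>\<^sub>M borel)"
  by (simp add: cond_indep_law_def sets_input_pair)

text \<open>
  The terms of the last identity are \<open>I(u; y)\<close>, \<open>I(x; y | u)\<close> and the divergence of the output law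
  from that of the reference input \<open>p'\<close>.
\<close>

lemma information_decomposition:
  fixes c :: "complex ^ 'n" and p' :: "('v \<times> complex) measure"
  defines "L \<equiv> \<lambda>z. log 2 (noise_density (snd z - snd (fst z) *s c) / output_density p' c (snd z))"
  assumes "input_law p' U'" and int: "integrable (joint_law p c) L"
  shows "integrable (message_output_law c) (entropy_density 2 (message_law \<Otimes>\<^sub>M output_law p c) (message_output_law c))"
    and "absolutely_continuous (cond_indep_law c) (joint_law p c)"
    and "integrable (joint_law p c) (entropy_density 2 (cond_indep_law c) (joint_law p c))"
    and "absolutely_continuous (output_law p' c) (output_law p c)"
    and "integrable (output_law p c) (entropy_density 2 (output_law p' c) (output_law p c))"
    and "KL_divergence 2 (message_law \<Otimes>\<^sub>M output_law p c) (message_output_law c)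
       + KL_divergence 2 (cond_indep_law c) (joint_law p c)
       + KL_divergence 2 (output_law p' c) (output_law p c) = (\<integral>z. L z \<partial>joint_law p c)"
proof -
  interpret p': input_law p' U' by fact
  let ?J = "joint_law p c" and ?O = "output_law p c" and ?G = "output_law p' c"
  \<comment> \<open>The densities of the joint law relative to \<open>p\<close> times the reference
    output, of the joint law relative to \<open>p\<close> times its own output, and of the output
    relative to the reference output. The identity rests on \<open>?e = ?f * ?g\<close> and, once
    \<open>r\<close> is available, on \<open>?f = r * (?f / r)\<close>.\<close>
  let ?e = "\<lambda>z. noise_density (snd z - snd (fst z) *s c) / output_density p' c (snd z)"
  let ?f = "\<lambda>z. noise_density (snd z - snd (fst z) *s c) / output_density p c (snd z)"
  let ?g = "\<lambda>y. output_density p c y / output_density p' c y"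
  let ?T = "\<lambda>z :: ('u \<times> complex) \<times> (complex ^ 'n). (fst (fst z), snd z)"
  have sG[measurable_cong]: "sets (p \<Otimes>\<^sub>M ?G) = sets (p \<Otimes>\<^sub>M borel)" by (rule sets_pair_measure_cong) auto
  note sets_input_pair[measurable_cong]
  have [measurable]: "output_density p' c \<in> borel_measurable borel" by (rule p'.borel_measurable_output_density)
  have pos: "0 < output_density p c y" "0 < output_density p' c y" for y
    by (rule output_density_pos, rule p'.output_density_pos)
  have e0: "0 \<le> ?e z" and f0: "0 \<le> ?f z" and g0: "0 \<le> ?g y" for z y
    by (intro divide_nonneg_nonneg less_imp_le[OF noise_density_pos] less_imp_le[OF pos(1)] less_imp_le[OF pos(2)])+
  have pG: "prob_space (p \<Otimes>\<^sub>M ?G)" by (intro prob_space_pair prob_space_axioms p'.prob_space_output_law)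
  have JG: "?J = density (p \<Otimes>\<^sub>M ?G) (\<lambda>z. ennreal (?e z))"
    using joint_law_eq_density[of "output_density p' c" c] pos
      p'.prob_space_output_law[of c, THEN prob_space_imp_sigma_finite]
    unfolding p'.output_law_eq_density by (simp add: case_prod_unfold)
  have acG: "absolutely_continuous (p \<Otimes>\<^sub>M ?G) ?J"
    unfolding JG by (rule absolutely_continuousI_density) measurable
  have "integrable ?J (entropy_density 2 (p \<Otimes>\<^sub>M ?G) ?J)"
    using int unfolding L_def by (subst KL_divergence_density(1)[OF pG _ _ JG]) (auto simp: e0)
  \<comment> \<open>Only the logarithm of \<open>?e\<close> is known to be integrable. Projection to
    the output yields the same for \<open>?g\<close> by data processing, subtraction yields it for
    \<open>?f\<close>, and forgetting \<open>x\<close> yields it for \<open>r\<close>.\<close>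
  note dpi = KL_divergence_data_processing(1)[OF _ pG prob_space_joint_law _ acG this, of snd borel]
  have G': "distr (p \<Otimes>\<^sub>M ?G) borel snd = ?G"
  proof -
    have "distr (p \<Otimes>\<^sub>M ?G) borel snd = distr (p \<Otimes>\<^sub>M ?G) ?G snd" by (rule distr_cong) auto
    also have "\<dots> = ?G"
      by (intro distr_pair_snd prob_space_axioms p'.prob_space_output_law prob_space_imp_sigma_finite)
    finally show ?thesis .
  qed
  have OG: "?O = density ?G (\<lambda>y. ennreal (?g y))"
  proof -
    have "ennreal (output_density p' c y) * ennreal (?g y) = ennreal (output_density p c y)" for y
      using pos[of y] by (subst ennreal_mult'[symmetric]) auto
    then show ?thesis unfolding output_law_eq_density p'.output_law_eq_density by (simp add: density_density_eq)
  qed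
  show acO: "absolutely_continuous ?G ?O"
    unfolding OG by (rule absolutely_continuousI_density) measurable
  show iO: "integrable ?O (entropy_density 2 ?G ?O)"
    using dpi by (simp add: G' sG sets_joint_law flip: output_law_def)
  note KO = KL_divergence_density[OF p'.prob_space_output_law _ g0 OG]
  have "integrable ?O (\<lambda>y. log 2 (?g y))" using iO by (subst (asm) KO(1)) auto
  then have ig: "integrable ?J (\<lambda>z. log 2 (?g (snd z)))"
    unfolding output_law_def by (subst (asm) integrable_distr_eq) auto
  have Kg: "KL_divergence 2 ?G ?O = (\<integral>z. log 2 (?g (snd z)) \<partial>?J)"
    using integral_distr[of snd ?J borel "\<lambda>y. log 2 (?g y)"] by (subst KO(2)) (auto simp flip: output_law_def)
  have efg: "log 2 (?e z) = log 2 (?f z) + log 2 (?g (snd z))" for z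
    using pos noise_density_pos[of "snd z - snd (fst z) *s c"] by (simp add: log_divide less_imp_neq[THEN not_sym])
  have if': "integrable ?J (\<lambda>z. log 2 (?f z))"
    using Bochner_Integration.integrable_diff[OF int ig] unfolding L_def efg by simp
  have Jf: "?J = density (p \<Otimes>\<^sub>M ?O) (\<lambda>z. ennreal (?f z))"
    using joint_law_eq_density_output[of c] by (simp add: case_prod_unfold)
  have "integrable ?J (entropy_density 2 (p \<Otimes>\<^sub>M ?O) ?J)"
    using if' by (subst KL_divergence_density(1)[OF prob_space_input_pair _ _ Jf]) (auto simp: f0)
  note dpi = KL_divergence_data_processing(1)[OF _ prob_space_input_pair prob_space_joint_law _ ac_joint this, of ?T "U \<Otimes>\<^sub>M borel"]
  show iI: "integrable (message_output_law c) (entropy_density 2 (message_law \<Otimes>\<^sub>M ?O) (message_output_law c))"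
    unfolding message_pair_eq message_output_law_def
    using dpi by (simp add: sets_input_pair sets_joint_law case_prod_unfold)
  obtain r where r[measurable]: "r \<in> borel_measurable (U \<Otimes>\<^sub>M borel)" and r0: "\<And>z. 0 \<le> r z"
    and M: "message_output_law c = density (message_law \<Otimes>\<^sub>M output_law p c) (\<lambda>z. ennreal (r z))"
    and C: "cond_indep_law c = density (p \<Otimes>\<^sub>M output_law p c) (\<lambda>(v, y). ennreal (r (fst v, y)))"
    and rpos: "AE z in p \<Otimes>\<^sub>M output_law p c. 0 < r (fst (fst z), snd z)"
    using real_density_message[of c] by blast
  have r': "r \<in> borel_measurable (message_law \<Otimes>\<^sub>M ?O)"
    using r by (simp add: measurable_cong_sets[OF sets_message_pair refl])
  note KI = KL_divergence_density[OF prob_space_message_pair r' r0 M]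
  have mol: "message_output_law c = distr ?J (U \<Otimes>\<^sub>M borel) ?T"
    by (simp add: message_output_law_def case_prod_unfold)
  have "integrable (message_output_law c) (\<lambda>z. log 2 (r z))" using iI by (subst (asm) KI(1))
  then have ir: "integrable ?J (\<lambda>z. log 2 (r (?T z)))"
    unfolding mol by (subst (asm) integrable_distr_eq) auto
  have Kr: "KL_divergence 2 (message_law \<Otimes>\<^sub>M ?O) (message_output_law c) = (\<integral>z. log 2 (r (?T z)) \<partial>?J)"
    unfolding KI(2) unfolding mol by (subst integral_distr) auto
  have C': "cond_indep_law c = density (p \<Otimes>\<^sub>M ?O) (\<lambda>z. ennreal (r (?T z)))"
    using C by (simp add: case_prod_unfold)
  \<comment> \<open>Both laws have densities relative to the same product, and \<open>r\<close> is
    positive almost everywhere there, so their quotient is the density of one relative to the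
    other.\<close>
  have JC: "?J = density (cond_indep_law c) (\<lambda>z. ennreal (?f z / r (?T z)))"
  proof -
    have "density (cond_indep_law c) (\<lambda>z. ennreal (?f z / r (?T z)))
      = density (p \<Otimes>\<^sub>M ?O) (\<lambda>z. ennreal (r (?T z)) * ennreal (?f z / r (?T z)))"
      unfolding C' by (rule density_density_eq) measurable
    also have "\<dots> = ?J"
      unfolding Jf
    proof (rule density_cong)
      show "AE z in p \<Otimes>\<^sub>M ?O. ennreal (r (?T z)) * ennreal (?f z / r (?T z)) = ennreal (?f z)"
        using rpos by eventually_elim (subst ennreal_mult'[symmetric], auto)
    qed measurable
    finally show ?thesis ..
  qed
  have fr0: "0 \<le> ?f z / r (?T z)" for z by (rule divide_nonneg_nonneg[OF f0 r0])
  show acC: "absolutely_continuous (cond_indep_law c) ?J"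
    by (subst JC, rule absolutely_continuousI_density) measurable
  have rJ: "AE z in ?J. 0 < r (?T z)"
    using absolutely_continuous_AE[OF _ ac_joint rpos] by (simp add: sets_joint_law sets_input_pair)
  have lfr: "AE z in ?J. log 2 (?f z) - log 2 (r (?T z)) = log 2 (?f z / r (?T z))"
    using rJ
  proof eventually_elim
    case (elim z)
    have "0 < ?f z" using pos noise_density_pos by (intro divide_pos_pos)
    then show ?case using elim by (simp only: log_divide_pos)
  qed
  have ifr: "integrable ?J (\<lambda>z. log 2 (?f z / r (?T z)))"
    by (rule integrable_cong_AE_imp[OF Bochner_Integration.integrable_diff[OF if' ir] _ lfr]) measurable
  have mfr: "(\<lambda>z. ?f z / r (?T z)) \<in> borel_measurable (cond_indep_law c)" by measurable
  note KC = KL_divergence_density[OF prob_space_cond_indep_law mfr fr0 JC]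
  show "integrable ?J (entropy_density 2 (cond_indep_law c) ?J)"
    using ifr by (subst KC(1))
  have "KL_divergence 2 (cond_indep_law c) ?J = (\<integral>z. log 2 (?f z / r (?T z)) \<partial>?J)" by (rule KC(2))
  also have "\<dots> = (\<integral>z. log 2 (?f z) - log 2 (r (?T z)) \<partial>?J)"
    using lfr by (intro integral_cong_AE) auto
  also have "\<dots> = (\<integral>z. log 2 (?f z) \<partial>?J) - (\<integral>z. log 2 (r (?T z)) \<partial>?J)"
    by (rule Bochner_Integration.integral_diff[OF if' ir])
  finally have "KL_divergence 2 (cond_indep_law c) ?J = (\<integral>z. log 2 (?f z) \<partial>?J) - (\<integral>z. log 2 (r (?T z)) \<partial>?J)" .
  moreover have "(\<integral>z. L z \<partial>?J) = (\<integral>z. log 2 (?f z) \<partial>?J) + (\<integral>z. log 2 (?g (snd z)) \<partial>?J)"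
    unfolding L_def efg by (rule Bochner_Integration.integral_add[OF if' ig])
  ultimately show "KL_divergence 2 (message_law \<Otimes>\<^sub>M ?O) (message_output_law c)
       + KL_divergence 2 (cond_indep_law c) ?J + KL_divergence 2 ?G ?O = (\<integral>z. L z \<partial>?J)"
    by (simp add: Kr Kg)
qed

end

subsection \<open>Degraded channels\<close>

text \<open>\<open>F\<close> is constrained by the two channels alone, so one and the same
  \<open>F\<close> can be used for the given input and for the reference input. Comparing the
  divergences of their output laws requires this.\<close>

locale degraded_channel = input_law p U for p :: "('u \<times> complex) measure" and U +
  fixes c :: "complex ^ 'b" and d :: "complex ^ 'e" and F :: "(complex ^ 'b) \<times> (complex ^ 'e) \<Rightarrow> complex ^ 'e"
  assumes F_borel: "F \<in> borel_measurable borel"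
    and F_shift: "\<And>x w v. F (x *s c + w, v) = x *s d + F (w, v)"
    and F_law: "distr std_gaussian borel F = std_gaussian"
begin

lemma F_measurable[measurable]: "F \<in> borel \<Otimes>\<^sub>M borel \<rightarrow>\<^sub>M borel"
  using F_borel by (simp add: borel_prod)

sublocale noise: prob_space "std_gaussian :: (complex ^ 'e) measure"
  by (rule prob_space_std_gaussian)

lemmas degraded = nn_integral_degraded[OF F_borel F_shift F_law]

lemma joint_law_degraded:
  "distr (joint_law p c \<Otimes>\<^sub>M std_gaussian) (p \<Otimes>\<^sub>M borel) (\<lambda>z. (fst (fst z), F (snd (fst z), snd z))) = joint_law p d"
proof (rule measure_eqI_nn_integral)
  fix h :: "('u \<times> complex) \<times> (complex ^ 'e) \<Rightarrow> ennreal"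
  assume "h \<in> borel_measurable (distr (joint_law p c \<Otimes>\<^sub>M std_gaussian) (p \<Otimes>\<^sub>M borel) (\<lambda>z. (fst (fst z), F (snd (fst z), snd z))))"
  then have [measurable]: "h \<in> borel_measurable (p \<Otimes>\<^sub>M borel)" by simp
  have "(\<integral>\<^sup>+z. h z \<partial>distr (joint_law p c \<Otimes>\<^sub>M std_gaussian) (p \<Otimes>\<^sub>M borel) (\<lambda>z. (fst (fst z), F (snd (fst z), snd z))))
    = (\<integral>\<^sup>+z. h (fst (fst z), F (snd (fst z), snd z)) \<partial>(joint_law p c \<Otimes>\<^sub>M std_gaussian))"
    by (rule nn_integral_distr) measurable
  also have "\<dots> = (\<integral>\<^sup>+z. \<integral>\<^sup>+w. h (fst z, F (snd z, w)) \<partial>std_gaussian \<partial>joint_law p c)"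
    by (subst noise.nn_integral_fst[symmetric]) auto
  also have "\<dots> = (\<integral>\<^sup>+z. h z \<partial>joint_law p d)" by (rule degraded) measurable
  finally show "(\<integral>\<^sup>+z. h z \<partial>distr (joint_law p c \<Otimes>\<^sub>M std_gaussian) (p \<Otimes>\<^sub>M borel) (\<lambda>z. (fst (fst z), F (snd (fst z), snd z)))) = \<dots>" .
qed (simp add: sets_joint_law)

lemma output_law_degraded:
  "distr (output_law p c \<Otimes>\<^sub>M std_gaussian) borel F = output_law p d"
proof (rule measure_eqI_nn_integral)
  fix h :: "complex ^ 'e \<Rightarrow> ennreal"
  assume "h \<in> borel_measurable (distr (output_law p c \<Otimes>\<^sub>M std_gaussian) borel F)"
  then have [measurable]: "h \<in> borel_measurable borel" by simp
  have "(\<integral>\<^sup>+z. h z \<partial>distr (output_law p c \<Otimes>\<^sub>M std_gaussian) borel F)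
    = (\<integral>\<^sup>+z. h (F z) \<partial>(output_law p c \<Otimes>\<^sub>M std_gaussian))"
    by (rule nn_integral_distr) measurable
  also have "\<dots> = (\<integral>\<^sup>+y. \<integral>\<^sup>+w. h (F (y, w)) \<partial>std_gaussian \<partial>output_law p c)"
    by (subst noise.nn_integral_fst[symmetric]) auto
  also have "\<dots> = (\<integral>\<^sup>+z. \<integral>\<^sup>+w. h (F (snd z, w)) \<partial>std_gaussian \<partial>joint_law p c)"
    unfolding output_law_def by (subst nn_integral_distr) auto
  also have "\<dots> = (\<integral>\<^sup>+z. h (snd z) \<partial>joint_law p d)"
    using degraded[of "\<lambda>z. h (snd z)"] by simp
  also have "\<dots> = (\<integral>\<^sup>+z. h z \<partial>output_law p d)"
    unfolding output_law_def by (subst nn_integral_distr) auto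
  finally show "(\<integral>\<^sup>+z. h z \<partial>distr (output_law p c \<Otimes>\<^sub>M std_gaussian) borel F) = \<dots>" .
qed simp

lemma nn_integral_message_output_degraded:
  assumes [measurable]: "h \<in> borel_measurable (U \<Otimes>\<^sub>M borel)"
  shows "(\<integral>\<^sup>+z. \<integral>\<^sup>+w. h (fst z, F (snd z, w)) \<partial>std_gaussian \<partial>message_output_law c) = (\<integral>\<^sup>+z. h z \<partial>message_output_law d)"
proof -
  have "(\<integral>\<^sup>+z. \<integral>\<^sup>+w. h (fst z, F (snd z, w)) \<partial>std_gaussian \<partial>message_output_law c)
    = (\<integral>\<^sup>+z. \<integral>\<^sup>+w. h (fst (fst z), F (snd z, w)) \<partial>std_gaussian \<partial>joint_law p c)"
    unfolding message_output_law_def by (subst nn_integral_distr) (auto simp: case_prod_unfold)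
  also have "\<dots> = (\<integral>\<^sup>+z. h (fst (fst z), snd z) \<partial>joint_law p d)"
    using degraded[of "\<lambda>z. h (fst (fst z), snd z)"] by simp
  also have "\<dots> = (\<integral>\<^sup>+z. h z \<partial>message_output_law d)"
    unfolding message_output_law_def by (subst nn_integral_distr) (auto simp: case_prod_unfold)
  finally show ?thesis .
qed

lemma message_output_law_degraded:
  "distr (message_output_law c \<Otimes>\<^sub>M std_gaussian) (U \<Otimes>\<^sub>M borel) (\<lambda>z. (fst (fst z), F (snd (fst z), snd z))) = message_output_law d"
proof (rule measure_eqI_nn_integral)
  fix h :: "'u \<times> (complex ^ 'e) \<Rightarrow> ennreal"
  assume "h \<in> borel_measurable (distr (message_output_law c \<Otimes>\<^sub>M std_gaussian) (U \<Otimes>\<^sub>M borel) (\<lambda>z. (fst (fst z), F (snd (fst z), snd z))))"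
  then have [measurable]: "h \<in> borel_measurable (U \<Otimes>\<^sub>M borel)" by simp
  have "(\<integral>\<^sup>+z. h z \<partial>distr (message_output_law c \<Otimes>\<^sub>M std_gaussian) (U \<Otimes>\<^sub>M borel) (\<lambda>z. (fst (fst z), F (snd (fst z), snd z))))
    = (\<integral>\<^sup>+z. h (fst (fst z), F (snd (fst z), snd z)) \<partial>(message_output_law c \<Otimes>\<^sub>M std_gaussian))"
    by (rule nn_integral_distr) measurable
  also have "\<dots> = (\<integral>\<^sup>+z. \<integral>\<^sup>+w. h (fst z, F (snd z, w)) \<partial>std_gaussian \<partial>message_output_law c)"
    by (subst noise.nn_integral_fst[symmetric]) auto
  also have "\<dots> = (\<integral>\<^sup>+z. h z \<partial>message_output_law d)" by (rule nn_integral_message_output_degraded) measurable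
  finally show "(\<integral>\<^sup>+z. h z \<partial>distr (message_output_law c \<Otimes>\<^sub>M std_gaussian) (U \<Otimes>\<^sub>M borel) (\<lambda>z. (fst (fst z), F (snd (fst z), snd z)))) = \<dots>" .
qed simp

lemma message_pair_degraded:
  "distr ((message_law \<Otimes>\<^sub>M output_law p c) \<Otimes>\<^sub>M std_gaussian) (U \<Otimes>\<^sub>M borel) (\<lambda>z. (fst (fst z), F (snd (fst z), snd z)))
    = message_law \<Otimes>\<^sub>M output_law p d" (is "?L = _")
proof (rule measure_eqI_nn_integral)
  fix h :: "'u \<times> (complex ^ 'e) \<Rightarrow> ennreal"
  assume "h \<in> borel_measurable ?L"
  then have [measurable]: "h \<in> borel_measurable (U \<Otimes>\<^sub>M borel)" by simp
  have "(\<integral>\<^sup>+z. h z \<partial>?L) = (\<integral>\<^sup>+z. h (fst (fst z), F (snd (fst z), snd z)) \<partial>((message_law \<Otimes>\<^sub>M output_law p c) \<Otimes>\<^sub>M std_gaussian))"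
    by (rule nn_integral_distr) measurable
  also have "\<dots> = (\<integral>\<^sup>+z. \<integral>\<^sup>+w. h (fst z, F (snd z, w)) \<partial>std_gaussian \<partial>(message_law \<Otimes>\<^sub>M output_law p c))"
    by (subst noise.nn_integral_fst[symmetric]) auto
  also have "\<dots> = (\<integral>\<^sup>+u. \<integral>\<^sup>+z. \<integral>\<^sup>+w. h (u, F (snd z, w)) \<partial>std_gaussian \<partial>joint_law p c \<partial>message_law)"
    by (subst nn_integral_message_pair) auto
  also have "\<dots> = (\<integral>\<^sup>+u. \<integral>\<^sup>+z. h (u, snd z) \<partial>joint_law p d \<partial>message_law)"
  proof (rule nn_integral_cong)
    fix u assume "u \<in> space message_law"
    then have [measurable]: "u \<in> space U" by (simp add: message_law_def)
    show "(\<integral>\<^sup>+z. \<integral>\<^sup>+w. h (u, F (snd z, w)) \<partial>std_gaussian \<partial>joint_law p c) = (\<integral>\<^sup>+z. h (u, snd z) \<partial>joint_law p d)"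
      using degraded[of "\<lambda>z. h (u, snd z)"] by simp
  qed
  also have "\<dots> = (\<integral>\<^sup>+z. h z \<partial>(message_law \<Otimes>\<^sub>M output_law p d))"
    by (rule nn_integral_message_pair[symmetric]) measurable
  finally show "(\<integral>\<^sup>+z. h z \<partial>?L) = \<dots>" .
qed (simp add: sets_message_pair)

text \<open>The inner integral is a function of the message only.
  \<open>nn_integral_message_output_law_density\<close> isolates the same function in an integral
  over messages, which is how values under \<open>cond_indep_law\<close> are reduced to
  \<open>message_output_law\<close>.\<close>

lemma nn_integral_cond_indep_law:
  fixes a :: "complex ^ 'n"
  assumes [measurable]: "r \<in> borel_measurable (U \<Otimes>\<^sub>M borel)" "f \<in> borel_measurable borel"
    and C: "cond_indep_law a = density (p \<Otimes>\<^sub>M output_law p a) (\<lambda>(v, y). ennreal (r (fst v, y)))"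
    and [measurable]: "X \<in> sets p"
  shows "(\<integral>\<^sup>+z. indicator X (fst z) * f (snd z) \<partial>cond_indep_law a) =
    (\<integral>\<^sup>+v. (\<integral>\<^sup>+y. ennreal (r (fst v, y)) * f y \<partial>output_law p a) * indicator X v \<partial>p)"
proof -
  interpret O: prob_space "output_law p a" by (rule prob_space_output_law)
  note sets_input_pair[measurable_cong]
  have "(\<integral>\<^sup>+z. indicator X (fst z) * f (snd z) \<partial>cond_indep_law a) =
     (\<integral>\<^sup>+z. ennreal (r (fst (fst z), snd z)) * (indicator X (fst z) * f (snd z)) \<partial>(p \<Otimes>\<^sub>M output_law p a))"
    unfolding C by (subst nn_integral_density) (auto simp: case_prod_unfold)
  also have "\<dots> = (\<integral>\<^sup>+v. \<integral>\<^sup>+y. ennreal (r (fst v, y)) * (indicator X v * f y) \<partial>output_law p a \<partial>p)"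
    by (subst O.nn_integral_fst[symmetric]) auto
  also have "\<dots> = (\<integral>\<^sup>+v. (\<integral>\<^sup>+y. ennreal (r (fst v, y)) * f y \<partial>output_law p a) * indicator X v \<partial>p)"
  proof (rule nn_integral_cong)
    fix v assume [measurable]: "v \<in> space p"
    show "(\<integral>\<^sup>+y. ennreal (r (fst v, y)) * (indicator X v * f y) \<partial>output_law p a) = (\<integral>\<^sup>+y. ennreal (r (fst v, y)) * f y \<partial>output_law p a) * indicator X v"
      by (subst nn_integral_multc[symmetric]) (auto simp: mult_ac)
  qed
  finally show ?thesis .
qed

lemma nn_integral_message_output_law_density:
  fixes a :: "complex ^ 'n"
  assumes [measurable]: "r \<in> borel_measurable (U \<Otimes>\<^sub>M borel)" "f \<in> borel_measurable borel"
    and M: "message_output_law a = density (message_law \<Otimes>\<^sub>M output_law p a) (\<lambda>z. ennreal (r z))"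
    and [measurable]: "A \<in> sets U"
  shows "(\<integral>\<^sup>+z. indicator A (fst z) * f (snd z) \<partial>message_output_law a) =
    (\<integral>\<^sup>+u. (\<integral>\<^sup>+y. ennreal (r (u, y)) * f y \<partial>output_law p a) * indicator A u \<partial>message_law)"
proof -
  interpret O: prob_space "output_law p a" by (rule prob_space_output_law)
  note sets_message_pair[measurable_cong]
  have "(\<integral>\<^sup>+z. indicator A (fst z) * f (snd z) \<partial>message_output_law a) =
     (\<integral>\<^sup>+z. ennreal (r z) * (indicator A (fst z) * f (snd z)) \<partial>(message_law \<Otimes>\<^sub>M output_law p a))"
    unfolding M by (subst nn_integral_density) (auto simp: case_prod_unfold)
  also have "\<dots> = (\<integral>\<^sup>+u. \<integral>\<^sup>+y. ennreal (r (u, y)) * (indicator A u * f y) \<partial>output_law p a \<partial>message_law)"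
    by (subst O.nn_integral_fst[symmetric]) auto
  also have "\<dots> = (\<integral>\<^sup>+u. (\<integral>\<^sup>+y. ennreal (r (u, y)) * f y \<partial>output_law p a) * indicator A u \<partial>message_law)"
  proof (rule nn_integral_cong)
    fix u assume "u \<in> space message_law"
    then have [measurable]: "u \<in> space U" by (simp add: message_law_def)
    show "(\<integral>\<^sup>+y. ennreal (r (u, y)) * (indicator A u * f y) \<partial>output_law p a) = (\<integral>\<^sup>+y. ennreal (r (u, y)) * f y \<partial>output_law p a) * indicator A u"
      by (subst nn_integral_multc[symmetric]) (auto simp: mult_ac)
  qed
  finally show ?thesis .
qed

text \<open>Processing \<open>y\<close> with independent noise keeps it independent of
  \<open>x\<close> given \<open>u\<close>. In terms of densities: the conditional probability of
  \<open>Y\<close> given the message is the same whether computed through \<open>c\<close> and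
  \<open>F\<close> or directly through \<open>d\<close>, because both versions integrate to
  \<open>message_output_law d\<close> over message sets.\<close>

lemma cond_indep_law_degraded:
  "distr (cond_indep_law c \<Otimes>\<^sub>M std_gaussian) (p \<Otimes>\<^sub>M borel) (\<lambda>z. (fst (fst z), F (snd (fst z), snd z))) = cond_indep_law d"
    (is "?L = _")
proof (rule finite_measure_eqI_rectangles)
  interpret C: prob_space "cond_indep_law c" by (rule prob_space_cond_indep_law)
  interpret m: prob_space message_law by (rule prob_space_message_law)
  interpret Oc: prob_space "output_law p c" by (rule prob_space_output_law)
  interpret Od: prob_space "output_law p d" by (rule prob_space_output_law)
  interpret CN: prob_space "cond_indep_law c \<Otimes>\<^sub>M (std_gaussian :: (complex ^ 'e) measure)"
    by (intro prob_space_pair C.prob_space_axioms prob_space_std_gaussian)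
  show "finite_measure ?L" by (intro prob_space.finite_measure CN.prob_space_distr) measurable
  show "sets ?L = sets (p \<Otimes>\<^sub>M borel)" "sets (cond_indep_law d) = sets (p \<Otimes>\<^sub>M borel)"
    by (simp_all add: sets_cond_indep_law)
  fix X and Y :: "(complex ^ 'e) set" assume [measurable]: "X \<in> sets p" "Y \<in> sets borel"
  obtain r where r[measurable]: "r \<in> borel_measurable (U \<Otimes>\<^sub>M borel)" and "\<And>z. 0 \<le> r z"
    and M: "message_output_law c = density (message_law \<Otimes>\<^sub>M output_law p c) (\<lambda>z. ennreal (r z))"
    and C: "cond_indep_law c = density (p \<Otimes>\<^sub>M output_law p c) (\<lambda>(v, y). ennreal (r (fst v, y)))"
    and "AE z in p \<Otimes>\<^sub>M output_law p c. 0 < r (fst (fst z), snd z)"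
    using real_density_message[of c] by blast
  obtain s where s[measurable]: "s \<in> borel_measurable (U \<Otimes>\<^sub>M borel)" and "\<And>z. 0 \<le> s z"
    and M': "message_output_law d = density (message_law \<Otimes>\<^sub>M output_law p d) (\<lambda>z. ennreal (s z))"
    and C': "cond_indep_law d = density (p \<Otimes>\<^sub>M output_law p d) (\<lambda>(v, y). ennreal (s (fst v, y)))"
    and "AE z in p \<Otimes>\<^sub>M output_law p d. 0 < s (fst (fst z), snd z)"
    using real_density_message[of d] by blast
  define f where "f y = (\<integral>\<^sup>+w. indicator Y (F (y, w)) \<partial>std_gaussian)" for y
  have [measurable]: "f \<in> borel_measurable borel" unfolding f_def by measurable
  \<comment> \<open>\<open>k\<close> and \<open>k'\<close> are versions of the conditional
    probability, given the message, that the degraded output lies in \<open>Y\<close>: the first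
    through the output of \<open>c\<close>, the second through that of \<open>d\<close>.\<close>
  define k where "k u = (\<integral>\<^sup>+y. ennreal (r (u, y)) * f y \<partial>output_law p c)" for u
  define k' where "k' u = (\<integral>\<^sup>+y. ennreal (s (u, y)) * indicator Y y \<partial>output_law p d)" for u
  have [measurable]: "k \<in> borel_measurable U" "k' \<in> borel_measurable U"
    unfolding k_def k'_def by measurable
  have "AE u in message_law. k u = k' u"
  proof (rule m.density_unique_finite_measure)
    fix A assume "A \<in> sets message_law"
    then have [measurable]: "A \<in> sets U" by simp
    have "(\<integral>\<^sup>+u. k u * indicator A u \<partial>message_law) = (\<integral>\<^sup>+z. indicator A (fst z) * f (snd z) \<partial>message_output_law c)"
      unfolding k_def by (rule nn_integral_message_output_law_density[OF _ _ M, symmetric]) measurable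
    also have "\<dots> = (\<integral>\<^sup>+z. \<integral>\<^sup>+w. indicator A (fst z) * indicator Y (F (snd z, w)) \<partial>std_gaussian \<partial>message_output_law c)"
      unfolding f_def by (subst nn_integral_cmult) auto
    also have "\<dots> = (\<integral>\<^sup>+z. indicator A (fst z) * indicator Y (snd z) \<partial>message_output_law d)"
      using nn_integral_message_output_degraded[of "\<lambda>z. indicator A (fst z) * indicator Y (snd z)"] by simp
    also have "\<dots> = (\<integral>\<^sup>+u. k' u * indicator A u \<partial>message_law)"
      unfolding k'_def by (rule nn_integral_message_output_law_density[OF _ _ M']) measurable
    finally show "(\<integral>\<^sup>+u. k u * indicator A u \<partial>message_law) = (\<integral>\<^sup>+u. k' u * indicator A u \<partial>message_law)" .
  qed auto
  then have kk: "AE v in p. k (fst v) = k' (fst v)"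
    unfolding message_law_def by (rule AE_distrD[rotated]) measurable
  have "emeasure ?L (X \<times> Y) = (\<integral>\<^sup>+z. indicator (X \<times> Y) z \<partial>?L)"
    by (rule nn_integral_indicator[symmetric]) simp
  also have "\<dots> = (\<integral>\<^sup>+z. indicator (X \<times> Y) (fst (fst z), F (snd (fst z), snd z)) \<partial>(cond_indep_law c \<Otimes>\<^sub>M std_gaussian))"
    by (rule nn_integral_distr) measurable
  also have "\<dots> = (\<integral>\<^sup>+z. \<integral>\<^sup>+w. indicator X (fst z) * indicator Y (F (snd z, w)) \<partial>std_gaussian \<partial>cond_indep_law c)"
    by (subst noise.nn_integral_fst[symmetric]) (auto simp: indicator_times)
  also have "\<dots> = (\<integral>\<^sup>+z. indicator X (fst z) * f (snd z) \<partial>cond_indep_law c)"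
    unfolding f_def by (subst nn_integral_cmult) auto
  also have "\<dots> = (\<integral>\<^sup>+v. k (fst v) * indicator X v \<partial>p)"
    unfolding k_def by (rule nn_integral_cond_indep_law[OF _ _ C]) measurable
  also have "\<dots> = (\<integral>\<^sup>+v. k' (fst v) * indicator X v \<partial>p)"
    using kk by (intro nn_integral_cong_AE) auto
  also have "\<dots> = (\<integral>\<^sup>+z. indicator X (fst z) * indicator Y (snd z) \<partial>cond_indep_law d)"
    unfolding k'_def by (rule nn_integral_cond_indep_law[OF _ _ C', symmetric]) measurable
  also have "\<dots> = (\<integral>\<^sup>+z. indicator (X \<times> Y) z \<partial>cond_indep_law d)"
    by (simp add: indicator_times)
  also have "\<dots> = emeasure (cond_indep_law d) (X \<times> Y)"
    by (rule nn_integral_indicator) (simp add: sets_cond_indep_law)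
  finally show "emeasure ?L (X \<times> Y) = emeasure (cond_indep_law d) (X \<times> Y)" .
qed

end

text \<open>The reference input \<open>p'\<close> stays arbitrary, as the same \<open>F\<close>
  degrades its outputs too. Only the evaluation of the two integrals on the right calls for a
  Gaussian one.\<close>

lemma (in input_law) information_difference_le:
  fixes c :: "complex ^ 'b" and d :: "complex ^ 'e" and p' :: "('v \<times> complex) measure"
  assumes le: "norm d \<le> norm c" and p': "input_law p' U'"
    and ic: "integrable (joint_law p c) (\<lambda>z. log 2 (noise_density (snd z - snd (fst z) *s c) / output_density p' c (snd z)))"
    and id: "integrable (joint_law p d) (\<lambda>z. log 2 (noise_density (snd z - snd (fst z) *s d) / output_density p' d (snd z)))"
  shows "KL_divergence 2 (message_law \<Otimes>\<^sub>M output_law p d) (message_output_law d)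
     \<le> KL_divergence 2 (message_law \<Otimes>\<^sub>M output_law p c) (message_output_law c)"
    and "KL_divergence 2 (message_law \<Otimes>\<^sub>M output_law p c) (message_output_law c)
     - KL_divergence 2 (message_law \<Otimes>\<^sub>M output_law p d) (message_output_law d)
     \<le> (\<integral>z. log 2 (noise_density (snd z - snd (fst z) *s c) / output_density p' c (snd z)) \<partial>joint_law p c)
       - (\<integral>z. log 2 (noise_density (snd z - snd (fst z) *s d) / output_density p' d (snd z)) \<partial>joint_law p d)"
proof -
  interpret p': input_law p' U' by fact
  obtain F :: "(complex ^ 'b) \<times> (complex ^ 'e) \<Rightarrow> complex ^ 'e" where F: "F \<in> borel_measurable borel"
    "\<And>x w v. F (x *s c + w, v) = x *s d + F (w, v)" "distr std_gaussian borel F = std_gaussian"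
    using obtain_degrading_map[OF le] by blast
  interpret D: degraded_channel p U c d F by unfold_locales fact+
  interpret D': degraded_channel p' U' c d F by unfold_locales fact+
  note Dc = information_decomposition[OF p' ic] and Dd = information_decomposition[OF p' id]
  show I: "KL_divergence 2 (message_law \<Otimes>\<^sub>M output_law p d) (message_output_law d)
     \<le> KL_divergence 2 (message_law \<Otimes>\<^sub>M output_law p c) (message_output_law c)"
    unfolding D.message_output_law_degraded[symmetric] D.message_pair_degraded[symmetric]
    by (rule KL_divergence_data_processing_noise[OF _ prob_space_message_pair prob_space_message_output_law
          prob_space_std_gaussian _ ac_message Dc(1)]) (simp_all add: sets_message_pair)
  have J: "KL_divergence 2 (cond_indep_law d) (joint_law p d) \<le> KL_divergence 2 (cond_indep_law c) (joint_law p c)"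
    unfolding D.joint_law_degraded[symmetric] D.cond_indep_law_degraded[symmetric]
    by (rule KL_divergence_data_processing_noise[OF _ prob_space_cond_indep_law prob_space_joint_law
          prob_space_std_gaussian _ Dc(2,3)]) (simp_all add: sets_joint_law sets_cond_indep_law)
  have D: "KL_divergence 2 (output_law p' d) (output_law p d) \<le> KL_divergence 2 (output_law p' c) (output_law p c)"
    unfolding D.output_law_degraded[symmetric] D'.output_law_degraded[symmetric]
    by (rule KL_divergence_data_processing_noise[OF _ p'.prob_space_output_law prob_space_output_law
          prob_space_std_gaussian _ Dc(4,5)]) simp_all
  show "KL_divergence 2 (message_law \<Otimes>\<^sub>M output_law p c) (message_output_law c)
     - KL_divergence 2 (message_law \<Otimes>\<^sub>M output_law p d) (message_output_law d)
     \<le> (\<integral>z. log 2 (noise_density (snd z - snd (fst z) *s c) / output_density p' c (snd z)) \<partial>joint_law p c)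
       - (\<integral>z. log 2 (noise_density (snd z - snd (fst z) *s d) / output_density p' d (snd z)) \<partial>joint_law p d)"
    using Dc(6) Dd(6) J D by linarith
qed

subsection \<open>Gaussian inputs\<close>

lemma sets_complex_gaussian[measurable_cong, simp]: "sets (complex_gaussian v) = sets borel"
  by (simp add: complex_gaussian_def)

lemma space_complex_gaussian[simp]: "space (complex_gaussian v) = UNIV"
  by (simp add: complex_gaussian_def)

lemma complex_gaussian_eq_distr:
  assumes "0 < v"
  shows "complex_gaussian v = distr std_gaussian borel (\<lambda>x. sqrt v *\<^sub>R x)"
proof -
  let ?T = "\<lambda>x::complex. sqrt v *\<^sub>R x"
  let ?f = "\<lambda>x. ennreal (exp (- (cmod x)\<^sup>2 / v) / (pi * v))"
  \<comment> \<open>The factor \<open>v\<close> is the Jacobian \<open>(sqrt v)^2\<close> of the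
    scaling, \<open>complex\<close> having real dimension two.\<close>
  have "complex_gaussian v = density (density (distr lborel borel ?T) (\<lambda>_. ennreal v)) ?f"
    using lborel_affine[of "sqrt v" "0::complex"] assms unfolding complex_gaussian_def by simp
  also have "\<dots> = density (distr lborel borel ?T) (\<lambda>x. ennreal v * ?f x)"
    by (rule density_density_eq) auto
  also have "\<dots> = distr (density lborel (\<lambda>x. ennreal v * ?f (?T x))) borel ?T"
    by (rule density_distr) auto
  also have "density lborel (\<lambda>x. ennreal v * ?f (?T x)) = std_gaussian"
    unfolding std_gaussian_def
    by (intro arg_cong2[where f = density] refl ext)
       (use assms in \<open>auto simp: ennreal_mult'[symmetric] power_mult_distrib\<close>)
  finally show ?thesis .
qed

lemma prob_space_complex_gaussian: "0 < v \<Longrightarrow> prob_space (complex_gaussian v)"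
  unfolding complex_gaussian_eq_distr
  by (intro prob_space.prob_space_distr prob_space_std_gaussian) measurable

lemma complex_gaussian_power:
  assumes "0 < v"
  shows "integrable (complex_gaussian v) (\<lambda>x. (cmod x)\<^sup>2)" "(\<integral>x. (cmod x)\<^sup>2 \<partial>complex_gaussian v) = v"
proof -
  have eq: "(cmod (sqrt v *\<^sub>R x))\<^sup>2 = v * (norm x)\<^sup>2" for x
    using assms by (simp add: power_mult_distrib)
  have i: "integrable std_gaussian (\<lambda>x::complex. v * (norm x)\<^sup>2)"
    by (intro integrable_mult_right std_gaussian_norm_square)
  show "integrable (complex_gaussian v) (\<lambda>x. (cmod x)\<^sup>2)"
    unfolding complex_gaussian_eq_distr[OF assms]
    by (subst integrable_distr_eq) (simp_all only: eq i, measurable)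
  show "(\<integral>x. (cmod x)\<^sup>2 \<partial>complex_gaussian v) = v"
    unfolding complex_gaussian_eq_distr[OF assms]
    by (subst integral_distr) (simp_all only: eq, measurable, simp add: std_gaussian_norm_square)
qed

lemma measurable_diagonal: "(\<lambda>x. (x, x)) \<in> complex_gaussian v \<rightarrow>\<^sub>M borel \<Otimes>\<^sub>M borel"
  by measurable

lemma input_law_gaussian:
  assumes "0 < P"
  shows "input_law (gaussian_input P) borel"
proof (intro input_law.intro input_law_axioms.intro)
  show "prob_space (gaussian_input P)" unfolding gaussian_input_def
    by (intro prob_space.prob_space_distr prob_space_complex_gaussian assms measurable_diagonal)
qed (simp add: gaussian_input_def)

text \<open>The total mass of \<open>complex_gaussian (1 / s)\<close>, translated by
  \<open>m\<close> and multiplied by the normalising constant.\<close>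

lemma nn_integral_exp_cmod_square:
  assumes "0 < s"
  shows "(\<integral>\<^sup>+x. ennreal (exp (- (s * (cmod (x - m))\<^sup>2))) \<partial>lborel) = ennreal (pi / s)"
proof -
  have "1 = emeasure (complex_gaussian (1 / s)) (space (complex_gaussian (1 / s)))"
    using prob_space.emeasure_space_1[OF prob_space_complex_gaussian[of "1 / s"]] assms by simp
  also have "\<dots> = (\<integral>\<^sup>+x. ennreal (exp (- (s * (cmod x)\<^sup>2)) / (pi / s)) \<partial>lborel)"
    unfolding complex_gaussian_def using assms by (subst emeasure_density) (auto simp: mult.commute)
  also have "\<dots> = (\<integral>\<^sup>+x. ennreal (exp (- (s * (cmod (x - m))\<^sup>2)) / (pi / s)) \<partial>lborel)"
    using nn_integral_lborel_translate[of "\<lambda>x. ennreal (exp (- (s * (cmod x)\<^sup>2)) / (pi / s))" "- m"] by simp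
  finally have 1: "(\<integral>\<^sup>+x. ennreal (exp (- (s * (cmod (x - m))\<^sup>2)) / (pi / s)) \<partial>lborel) = 1" ..
  have "(\<integral>\<^sup>+x. ennreal (exp (- (s * (cmod (x - m))\<^sup>2))) \<partial>lborel)
      = (\<integral>\<^sup>+x. ennreal (pi / s) * ennreal (exp (- (s * (cmod (x - m))\<^sup>2)) / (pi / s)) \<partial>lborel)"
    using assms by (intro nn_integral_cong, subst ennreal_mult'[symmetric]) auto
  also have "\<dots> = ennreal (pi / s)"
    by (subst nn_integral_cmult) (auto simp del: times_divide_eq_right divide_divide_eq_right simp: 1)
  finally show ?thesis .
qed

text \<open>The output is Gaussian with covariance \<open>I + P c c*\<close>: the determinant is
  \<open>1 + P * (norm c)^2\<close>, and the exponent is that of the inverse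
  \<open>I - P c c* / (1 + P * (norm c)^2)\<close>. The proof integrates \<open>x\<close> out by
  completing the square.\<close>

lemma output_density_gaussian:
  fixes c :: "complex ^ 'n"
  assumes P: "0 < P"
  shows "output_density (gaussian_input P) c y =
    noise_density y * exp (P * (cmod (hermitian c y))\<^sup>2 / (1 + P * (norm c)\<^sup>2)) / (1 + P * (norm c)\<^sup>2)"
    (is "_ = ?G")
proof -
  interpret G: input_law "gaussian_input P" borel by (rule input_law_gaussian[OF P])
  define t where "t = hermitian c y"
  \<comment> \<open>The coefficient of \<open>(cmod x)^2\<close> in the exponent, with
    \<open>(norm c)^2\<close> from the noise and \<open>1 / P\<close> from the input. Completing the
    square then centres \<open>x\<close> at \<open>t / s\<close>.\<close>
  define s where "s = (norm c)\<^sup>2 + 1 / P"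
  have s: "0 < s" using P by (simp add: s_def add_nonneg_pos)
  have Ps: "P * s = 1 + P * (norm c)\<^sup>2" using P by (simp add: s_def field_simps)
  have sq: "(norm (y - x *s c))\<^sup>2 + (cmod x)\<^sup>2 / P = s * (cmod (x - t / of_real s))\<^sup>2 + (norm y)\<^sup>2 - (cmod t)\<^sup>2 / s" for x
  proof -
    have "(norm (y - x *s c))\<^sup>2 = (norm y)\<^sup>2 - 2 * Re (cnj x * t) + (cmod x)\<^sup>2 * (norm c)\<^sup>2"
      using norm_add_smult_square[of y "- x" c] by (simp add: t_def vec.scale_minus_left)
    moreover have "s * (cmod (x - t / of_real s))\<^sup>2 = s * (cmod x)\<^sup>2 - 2 * Re (cnj x * t) + (cmod t)\<^sup>2 / s"
    proof -
      define m where "m = t / of_real s"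
      have t: "t = of_real s * m" using s by (simp add: m_def)
      have e1: "(cmod (x - m))\<^sup>2 = (cmod x)\<^sup>2 - 2 * Re (cnj x * m) + (cmod m)\<^sup>2"
        by (simp add: cmod_power2) (simp add: power2_eq_square algebra_simps)
      have e2: "Re (cnj x * t) = s * Re (cnj x * m)" by (simp add: t algebra_simps)
      have e3: "(cmod t)\<^sup>2 / s = s * (cmod m)\<^sup>2" using s by (simp add: t norm_mult power2_eq_square)
      show ?thesis unfolding m_def[symmetric] e1 e2 e3 by (simp add: algebra_simps)
    qed
    ultimately show ?thesis by (simp add: s_def algebra_simps)
  qed
  have "ennreal (output_density (gaussian_input P) c y) = (\<integral>\<^sup>+v. ennreal (noise_density (y - snd v *s c)) \<partial>gaussian_input P)"
    unfolding output_density_def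
    by (rule nn_integral_eq_integral[symmetric]) (auto simp: G.integrable_noise_density less_imp_le noise_density_pos)
  also have "\<dots> = (\<integral>\<^sup>+x. ennreal (noise_density (y - x *s c)) \<partial>complex_gaussian P)"
    unfolding gaussian_input_def by (subst nn_integral_distr) auto
  also have "\<dots> = (\<integral>\<^sup>+x. ennreal (exp (- (cmod x)\<^sup>2 / P) / (pi * P)) * ennreal (noise_density (y - x *s c)) \<partial>lborel)"
    unfolding complex_gaussian_def by (subst nn_integral_density) auto
  also have "\<dots> = (\<integral>\<^sup>+x. ennreal (noise_density y * exp ((cmod t)\<^sup>2 / s) / (pi * P)) * ennreal (exp (- (s * (cmod (x - t / of_real s))\<^sup>2))) \<partial>lborel)"
  proof (rule nn_integral_cong)
    fix x
    have "exp (- (cmod x)\<^sup>2 / P) * exp (- (norm (y - x *s c))\<^sup>2) = exp (- ((norm (y - x *s c))\<^sup>2 + (cmod x)\<^sup>2 / P))"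
      by (simp add: exp_add[symmetric])
    also have "\<dots> = exp (- (norm y)\<^sup>2) * exp ((cmod t)\<^sup>2 / s) * exp (- (s * (cmod (x - t / of_real s))\<^sup>2))"
      unfolding sq by (simp add: exp_add[symmetric])
    finally have "exp (- (cmod x)\<^sup>2 / P) / (pi * P) * noise_density (y - x *s c) =
      noise_density y * exp ((cmod t)\<^sup>2 / s) / (pi * P) * exp (- (s * (cmod (x - t / of_real s))\<^sup>2))"
      unfolding noise_density_def by (simp add: divide_simps)
    then show "ennreal (exp (- (cmod x)\<^sup>2 / P) / (pi * P)) * ennreal (noise_density (y - x *s c)) =
      ennreal (noise_density y * exp ((cmod t)\<^sup>2 / s) / (pi * P)) * ennreal (exp (- (s * (cmod (x - t / of_real s))\<^sup>2)))"
      by (metis ennreal_mult' ennreal_mult'' exp_ge_zero noise_density_pos less_imp_le)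
  qed
  also have "\<dots> = ennreal (noise_density y * exp ((cmod t)\<^sup>2 / s) / (pi * P)) * ennreal (pi / s)"
    by (subst nn_integral_cmult) (auto simp: nn_integral_exp_cmod_square[OF s])
  also have "\<dots> = ennreal (noise_density y * exp ((cmod t)\<^sup>2 / s) / (pi * P) * (pi / s))"
    using s by (intro ennreal_mult''[symmetric]) auto
  also have "noise_density y * exp ((cmod t)\<^sup>2 / s) / (pi * P) * (pi / s) = noise_density y * exp ((cmod t)\<^sup>2 / s) / (P * s)"
    by (simp add: field_simps)
  also have "(cmod t)\<^sup>2 / s = P * (cmod t)\<^sup>2 / (P * s)" using P by simp
  also have "noise_density y * exp (P * (cmod t)\<^sup>2 / (P * s)) / (P * s) = ?G"
    by (simp only: Ps t_def)
  finally show ?thesis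
    using G.output_density_pos[of c y] noise_density_pos[of y] P
    by (subst (asm) ennreal_inj) (auto simp: less_imp_le intro!: divide_nonneg_nonneg)
qed

text \<open>Splits the complex coordinate into two real ones, to which
  \<open>std_gaussian_moments\<close> applies.\<close>

lemma cmod_hermitian_square: "(cmod (hermitian c y))\<^sup>2 = (y \<bullet> c)\<^sup>2 + (y \<bullet> (\<i> *s c))\<^sup>2"
proof -
  have "y \<bullet> (\<i> *s c) = Im (hermitian c y)"
    unfolding inner_commute[of y] inner_smult by simp
  then show ?thesis
    by (simp add: cmod_power2 Re_hermitian inner_commute)
qed

text \<open>Substituting \<open>y = x *s c + w\<close> leaves a quadratic expression in
  \<open>x\<close> and \<open>w\<close>. The mixed term has mean zero and the pure noise term a
  known mean, so the expectation depends on the input only through its power.\<close>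

lemma log_ratio_gaussian:
  fixes c :: "complex ^ 'n"
  assumes P: "0 < P"
  shows "log 2 (noise_density w / output_density (gaussian_input P) c (x *s c + w)) =
    (ln (1 + P * (norm c)\<^sup>2) + ((norm c)\<^sup>2 * (cmod x)\<^sup>2 + 2 * (w \<bullet> (x *s c))
       - P * (cmod (hermitian c w))\<^sup>2) / (1 + P * (norm c)\<^sup>2)) / ln 2"
proof -
  define a where "a = (norm c)\<^sup>2"
  define t where "t = hermitian c w"
  define R where "R = w \<bullet> (x *s c)"
  have a: "0 \<le> a" by (simp add: a_def)
  have pos: "0 < 1 + P * a" using P a by (simp add: add_pos_nonneg)
  have R: "R = Re (cnj x * t)"
    unfolding R_def t_def inner_commute[of w] inner_smult ..
  have y: "(norm (x *s c + w))\<^sup>2 = (norm w)\<^sup>2 + 2 * R + (cmod x)\<^sup>2 * a"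
    using norm_add_smult_square[of w x c] by (simp add: R a_def t_def add.commute)
  have h: "hermitian c (x *s c + w) = x * of_real a + t"
    by (simp add: hermitian_add hermitian_smult hermitian_self a_def t_def)
  have h2: "(cmod (x * of_real a + t))\<^sup>2 = a\<^sup>2 * (cmod x)\<^sup>2 + 2 * a * R + (cmod t)\<^sup>2"
    by (simp add: R cmod_power2) (simp add: power2_eq_square algebra_simps)
  have "noise_density w / output_density (gaussian_input P) c (x *s c + w) =
    (1 + P * a) * exp (2 * R + (cmod x)\<^sup>2 * a - P * (a\<^sup>2 * (cmod x)\<^sup>2 + 2 * a * R + (cmod t)\<^sup>2) / (1 + P * a))"
  proof -
    have ratio: "exp (- u) / r / (exp (- v) / r * exp k / s) = s * exp (v - u - k)" if "0 < r" "0 < s" for u v k r s :: real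
      using that by (simp add: exp_diff exp_minus field_simps exp_add)
    show ?thesis
      unfolding output_density_gaussian[OF P] noise_density_def y h h2 a_def[symmetric]
      using pos by (subst ratio) simp_all
  qed
  then have "ln (noise_density w / output_density (gaussian_input P) c (x *s c + w)) =
    ln (1 + P * a) + (2 * R + (cmod x)\<^sup>2 * a - P * (a\<^sup>2 * (cmod x)\<^sup>2 + 2 * a * R + (cmod t)\<^sup>2) / (1 + P * a))"
    using pos by (simp add: ln_mult)
  \<comment> \<open>The coefficients collapse by
    \<open>a - P * a^2 / (1 + P * a) = a / (1 + P * a)\<close> and
    \<open>1 - P * a / (1 + P * a) = 1 / (1 + P * a)\<close>.\<close>
  also have "2 * R + (cmod x)\<^sup>2 * a - P * (a\<^sup>2 * (cmod x)\<^sup>2 + 2 * a * R + (cmod t)\<^sup>2) / (1 + P * a)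
    = (a * (cmod x)\<^sup>2 + 2 * R - P * (cmod t)\<^sup>2) / (1 + P * a)"
    using pos by (simp add: field_simps power2_eq_square)
  finally show ?thesis by (simp add: log_def a_def t_def R_def)
qed

section \<open>Bounds on the information in terms of the input power\<close>

context input_law
begin

lemma integral_log_ratio_gaussian:
  fixes c :: "complex ^ 'n" and P :: real
  defines "L \<equiv> \<lambda>z. log 2 (noise_density (snd z - snd (fst z) *s c) / output_density (gaussian_input P) c (snd z))"
  assumes P: "0 < P" and power: "integrable p (\<lambda>v. (cmod (snd v))\<^sup>2)"
  shows "integrable (joint_law p c) L"
    and "(\<integral>z. L z \<partial>joint_law p c) =
      (ln (1 + P * (norm c)\<^sup>2) + (norm c)\<^sup>2 * ((\<integral>v. (cmod (snd v))\<^sup>2 \<partial>p) - P) / (1 + P * (norm c)\<^sup>2)) / ln 2"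
proof -
  interpret G: input_law "gaussian_input P" borel by (rule input_law_gaussian[OF P])
  interpret N: prob_space "std_gaussian :: (complex ^ 'n) measure" by (rule prob_space_std_gaussian)
  interpret PN: pair_prob_space p "std_gaussian :: (complex ^ 'n) measure" ..
  let ?\<gamma> = "std_gaussian :: (complex ^ 'n) measure"
  note [measurable] = G.borel_measurable_output_density
  define q where "q = (\<integral>v. (cmod (snd v))\<^sup>2 \<partial>p)"
  have Lm[measurable]: "L \<in> borel_measurable (p \<Otimes>\<^sub>M borel)" unfolding L_def by measurable
  define X where "X z = (cmod (snd (fst z)))\<^sup>2" for z :: "('u \<times> complex) \<times> (complex ^ 'n)"
  define R where "R z = snd z \<bullet> (snd (fst z) *s c)" for z :: "('u \<times> complex) \<times> (complex ^ 'n)"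
  define H where "H z = (cmod (hermitian c (snd z)))\<^sup>2" for z :: "('u \<times> complex) \<times> (complex ^ 'n)"
  have fst: "distr (p \<Otimes>\<^sub>M ?\<gamma>) p fst = p" by (rule N.distr_pair_fst)
  have snd: "distr (p \<Otimes>\<^sub>M ?\<gamma>) ?\<gamma> snd = ?\<gamma>"
    by (intro distr_pair_snd prob_space_axioms N.sigma_finite_measure_axioms)
  have X: "integrable (p \<Otimes>\<^sub>M ?\<gamma>) X" "(\<integral>z. X z \<partial>(p \<Otimes>\<^sub>M ?\<gamma>)) = q"
    using integrable_distr_eq[of fst "p \<Otimes>\<^sub>M ?\<gamma>" p "\<lambda>v. (cmod (snd v))\<^sup>2"]
      integral_distr[of fst "p \<Otimes>\<^sub>M ?\<gamma>" p "\<lambda>v. (cmod (snd v))\<^sup>2"] power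
    by (simp_all add: fst X_def[abs_def] q_def)
  have h: "integrable ?\<gamma> (\<lambda>w. (cmod (hermitian c w))\<^sup>2)" "(\<integral>w. (cmod (hermitian c w))\<^sup>2 \<partial>?\<gamma>) = (norm c)\<^sup>2"
    unfolding cmod_hermitian_square by (auto simp: std_gaussian_moments norm_smult)
  have H: "integrable (p \<Otimes>\<^sub>M ?\<gamma>) H" "(\<integral>z. H z \<partial>(p \<Otimes>\<^sub>M ?\<gamma>)) = (norm c)\<^sup>2"
    using integrable_distr_eq[of snd "p \<Otimes>\<^sub>M ?\<gamma>" ?\<gamma> "\<lambda>w. (cmod (hermitian c w))\<^sup>2"]
      integral_distr[of snd "p \<Otimes>\<^sub>M ?\<gamma>" ?\<gamma> "\<lambda>w. (cmod (hermitian c w))\<^sup>2"] h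
    by (simp_all add: snd H_def[abs_def])
  have Rm[measurable]: "R \<in> borel_measurable (p \<Otimes>\<^sub>M ?\<gamma>)" unfolding R_def[abs_def] by measurable
  \<comment> \<open>The mixed term is dominated by \<open>X + H\<close> through
    \<open>a * b \<le> a^2 + b^2\<close>; this licenses the iterated integration that evaluates its
    mean.\<close>
  have R: "integrable (p \<Otimes>\<^sub>M ?\<gamma>) R"
  proof (rule Bochner_Integration.integrable_bound[OF Bochner_Integration.integrable_add[OF X(1) H(1)] Rm], rule AE_I2)
    fix z
    have "\<bar>R z\<bar> = \<bar>Re (cnj (snd (fst z)) * hermitian c (snd z))\<bar>"
      by (simp only: R_def inner_commute[of "snd z"] inner_smult)
    also have "\<dots> \<le> cmod (snd (fst z)) * cmod (hermitian c (snd z))"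
      by (metis abs_Re_le_cmod norm_mult complex_mod_cnj)
    also have "\<dots> \<le> X z + H z"
    proof -
      have "a * b \<le> a\<^sup>2 + b\<^sup>2" if "0 \<le> a" "0 \<le> b" for a b :: real
        using sum_squares_bound[of a b] mult_nonneg_nonneg[OF that] by linarith
      then show ?thesis unfolding X_def H_def by simp
    qed
    finally show "norm (R z) \<le> norm (X z + H z)" by simp
  qed
  \<comment> \<open>For fixed \<open>x\<close> the mixed term is linear in the centred
    noise.\<close>
  have R0: "(\<integral>z. R z \<partial>(p \<Otimes>\<^sub>M ?\<gamma>)) = 0"
  proof -
    have "(\<integral>z. R z \<partial>(p \<Otimes>\<^sub>M ?\<gamma>)) = (\<integral>v. \<integral>w. R (v, w) \<partial>?\<gamma> \<partial>p)"
      by (rule PN.integral_fst'[OF R, symmetric])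
    then show ?thesis by (simp add: R_def std_gaussian_moments)
  qed
  define s where "s = 1 + P * (norm c)\<^sup>2"
  have s: "0 < s" using P by (simp add: s_def add_pos_nonneg)
  let ?E = "\<lambda>z. (ln s + ((norm c)\<^sup>2 * X z + 2 * R z - P * H z) / s) / ln 2"
  have L: "L (v, snd v *s c + w) = ?E (v, w)" for v w
    using log_ratio_gaussian[OF P, of w c "snd v"] by (simp add: L_def X_def R_def H_def s_def)
  have "integrable (p \<Otimes>\<^sub>M ?\<gamma>) ?E"
    by (intro integrable_divide Bochner_Integration.integrable_add Bochner_Integration.integrable_diff integrable_mult_right X R H) simp
  then have "integrable (p \<Otimes>\<^sub>M ?\<gamma>) (\<lambda>z. L (fst z, snd (fst z) *s c + snd z))"
    by (simp add: L)
  then show "integrable (joint_law p c) L"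
    unfolding joint_law_def by (subst integrable_distr_eq) (auto simp: case_prod_unfold)
  have "(\<integral>z. L z \<partial>joint_law p c) = (\<integral>z. L (fst z, snd (fst z) *s c + snd z) \<partial>(p \<Otimes>\<^sub>M ?\<gamma>))"
    unfolding joint_law_def by (subst integral_distr) (auto simp: case_prod_unfold)
  also have "\<dots> = (\<integral>z. ?E z \<partial>(p \<Otimes>\<^sub>M ?\<gamma>))" by (simp add: L)
  \<comment> \<open>The \<open>- P\<close> beside the input power originates in \<open>H\<close>,
    the noise energy along \<open>c\<close>, whose mean is \<open>(norm c)^2\<close>.\<close>
  also have "\<dots> = (ln s + ((norm c)\<^sup>2 * q - P * (norm c)\<^sup>2) / s) / ln 2"
    using X H R R0 by (simp add: PN.prob_space)
  finally show "(\<integral>z. L z \<partial>joint_law p c) =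
      (ln (1 + P * (norm c)\<^sup>2) + (norm c)\<^sup>2 * ((\<integral>v. (cmod (snd v))\<^sup>2 \<partial>p) - P) / (1 + P * (norm c)\<^sup>2)) / ln 2"
    by (simp add: s_def q_def algebra_simps)
qed

lemma instantaneous_information_eq:
  fixes c :: "complex ^ 'n"
  shows "instantaneous_information U p c =
    KL_divergence 2 (message_law \<Otimes>\<^sub>M output_law p c) (message_output_law c)"
proof -
  let ?\<gamma> = "std_gaussian :: (complex ^ 'n) measure"
  let ?u = "\<lambda>((u :: 'u, x :: complex), w :: complex ^ 'n). u"
  let ?y = "\<lambda>((u :: 'u, x), w). x *s c + w"
  interpret N: prob_space ?\<gamma> by (rule prob_space_std_gaussian)
  interpret PN: pair_prob_space p ?\<gamma> ..
  have "distr (p \<Otimes>\<^sub>M ?\<gamma>) U ?u = distr (distr (p \<Otimes>\<^sub>M ?\<gamma>) p fst) U fst"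
    by (subst distr_distr) (auto simp: comp_def case_prod_unfold)
  then have 1: "distr (p \<Otimes>\<^sub>M ?\<gamma>) U ?u = message_law"
    unfolding N.distr_pair_fst message_law_def .
  have 2: "distr (p \<Otimes>\<^sub>M ?\<gamma>) borel ?y = output_law p c"
    unfolding output_law_def joint_law_def
    by (subst distr_distr) (auto simp: comp_def case_prod_unfold)
  have 3: "distr (p \<Otimes>\<^sub>M ?\<gamma>) (U \<Otimes>\<^sub>M borel) (\<lambda>z. (?u z, ?y z)) = message_output_law c"
    unfolding message_output_law_def joint_law_def
    by (subst distr_distr) (auto simp: comp_def case_prod_unfold)
  have "instantaneous_information U p c =
    KL_divergence 2 (distr (p \<Otimes>\<^sub>M ?\<gamma>) U ?u \<Otimes>\<^sub>M distr (p \<Otimes>\<^sub>M ?\<gamma>) borel ?y)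
      (distr (p \<Otimes>\<^sub>M ?\<gamma>) (U \<Otimes>\<^sub>M borel) (\<lambda>z. (?u z, ?y z)))"
    by (simp only: instantaneous_information_def complex_gaussian_noise_eq PN.mutual_information_def)
  then show ?thesis by (simp only: 1 2 3)
qed

lemma instantaneous_information_diff_le:
  fixes c :: "complex ^ 'b" and d :: "complex ^ 'e"
  assumes le: "norm d \<le> norm c" and P: "0 < P"
    and power: "integrable p (\<lambda>v. (cmod (snd v))\<^sup>2)" "(\<integral>v. (cmod (snd v))\<^sup>2 \<partial>p) \<le> P"
  shows "instantaneous_information U p d \<le> instantaneous_information U p c"
    and "instantaneous_information U p c - instantaneous_information U p d
      \<le> log 2 ((1 + P * (norm c)\<^sup>2) / (1 + P * (norm d)\<^sup>2))"
proof -
  note Lc = integral_log_ratio_gaussian[OF P power(1), of c] and Ld = integral_log_ratio_gaussian[OF P power(1), of d]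
  note diff = information_difference_le[OF le input_law_gaussian[OF P] Lc(1) Ld(1)]
  show "instantaneous_information U p d \<le> instantaneous_information U p c"
    unfolding instantaneous_information_eq by (rule diff(1))
  define q where "q = (\<integral>v. (cmod (snd v))\<^sup>2 \<partial>p)"
  define a b where "a = (norm c)\<^sup>2" "b = (norm d)\<^sup>2"
  have ab: "0 \<le> b" "b \<le> a" using le by (auto simp: a_b_def power_mono)
  have pos: "0 < 1 + P * a" "0 < 1 + P * b" using P ab by (simp_all add: add_pos_nonneg)
  \<comment> \<open>Monotonicity of \<open>t / (1 + P * t)\<close>: since
    \<open>q - P \<le> 0\<close>, a lack of power costs the stronger channel at least as much as the
    weaker one.\<close>
  have "b / (1 + P * b) \<le> a / (1 + P * a)"
    using pos ab by (simp add: divide_simps algebra_simps)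
  then have "a / (1 + P * a) * (q - P) \<le> b / (1 + P * b) * (q - P)"
    using power(2) by (intro mult_right_mono_neg) (auto simp: q_def)
  then have "(ln (1 + P * a) + a * (q - P) / (1 + P * a)) / ln 2 - (ln (1 + P * b) + b * (q - P) / (1 + P * b)) / ln 2
    \<le> (ln (1 + P * a) - ln (1 + P * b)) / ln 2"
    by (simp add: diff_divide_distrib[symmetric] divide_right_mono)
  also have "\<dots> = log 2 ((1 + P * a) / (1 + P * b))"
    using pos by (simp add: log_def ln_div)
  finally show "instantaneous_information U p c - instantaneous_information U p d
      \<le> log 2 ((1 + P * (norm c)\<^sup>2) / (1 + P * (norm d)\<^sup>2))"
    using diff(2) unfolding instantaneous_information_eq Lc(2) Ld(2) by (simp add: a_b_def q_def)
qed

end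

section \<open>The value attained by the Gaussian input\<close>

lemma gaussian_input_power:
  assumes P: "0 < P"
  shows "integrable (gaussian_input P) (\<lambda>v. (cmod (snd v))\<^sup>2)"
    and "(\<integral>v. (cmod (snd v))\<^sup>2 \<partial>gaussian_input P) = P"
proof -
  show "integrable (gaussian_input P) (\<lambda>v. (cmod (snd v))\<^sup>2)"
    unfolding gaussian_input_def using complex_gaussian_power(1)[OF P]
    by (subst integrable_distr_eq[OF measurable_diagonal]) simp_all
  have "(\<integral>v. (cmod (snd v))\<^sup>2 \<partial>gaussian_input P) = (\<integral>x. (cmod (snd (x, x)))\<^sup>2 \<partial>complex_gaussian P)"
    unfolding gaussian_input_def by (rule integral_distr[OF measurable_diagonal]) measurable
  then show "(\<integral>v. (cmod (snd v))\<^sup>2 \<partial>gaussian_input P) = P"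
    by (simp only: snd_conv complex_gaussian_power(2)[OF P])
qed

text \<open>The diagonal is closed, hence Borel, and on \<open>complex\<close> the product of the
  Borel algebras is the Borel algebra of the product; so the event is measurable and can be tested
  before the map \<open>(x, x)\<close>.\<close>

lemma AE_gaussian_input: "AE v in gaussian_input P. fst v = snd v"
proof -
  have "closed {v :: complex \<times> complex. fst v = snd v}"
    by (intro closed_Collect_eq continuous_intros)
  then have "{v :: complex \<times> complex. fst v = snd v} \<in> sets borel"
    by (rule borel_closed)
  then have m: "{v \<in> space ((borel :: complex measure) \<Otimes>\<^sub>M (borel :: complex measure)). fst v = snd v} \<in> sets (borel \<Otimes>\<^sub>M borel)"
    unfolding borel_prod by simp
  show ?thesis
    unfolding gaussian_input_def by (subst AE_distr_iff[OF measurable_diagonal m]) simp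
qed

text \<open>As \<open>u = x\<close> almost surely, the density of the joint law can be written as a
  function \<open>?f\<close> of \<open>(u, y)\<close>, and it is then also the density of the law of
  message and output. The information is thus the whole log-ratio integral, whose correction term
  vanishes because the power is exactly \<open>P\<close>.\<close>

lemma instantaneous_information_gaussian_input:
  fixes c :: "complex ^ 'n"
  assumes P: "0 < P"
  shows "instantaneous_information borel (gaussian_input P) c = log 2 (1 + P * (norm c)\<^sup>2)"
proof -
  let ?p = "gaussian_input P"
  interpret G: input_law ?p borel by (rule input_law_gaussian[OF P])
  interpret O: prob_space "output_law ?p c" by (rule G.prob_space_output_law)
  note G.sets_input_pair[measurable_cong]
  let ?J = "joint_law ?p c" and ?O = "output_law ?p c"
  let ?f = "\<lambda>z :: complex \<times> (complex ^ 'n). noise_density (snd z - fst z *s c) / output_density ?p c (snd z)"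
  let ?T = "\<lambda>z :: (complex \<times> complex) \<times> (complex ^ 'n). (fst (fst z), snd z)"
  let ?L = "\<lambda>z. log 2 (noise_density (snd z - snd (fst z) *s c) / output_density ?p c (snd z))"
  from AE_gaussian_input have "AE v in distr (?p \<Otimes>\<^sub>M ?O) ?p fst. fst v = snd v"
    unfolding O.distr_pair_fst .
  then have ae: "AE z in ?p \<Otimes>\<^sub>M ?O. fst (fst z) = snd (fst z)"
    by (rule AE_distrD[rotated]) measurable
  then have aeJ: "AE z in ?J. fst (fst z) = snd (fst z)"
    by (rule absolutely_continuous_AE[OF _ G.ac_joint, rotated]) (simp add: G.sets_joint_law G.sets_input_pair)
  have J: "?J = density (?p \<Otimes>\<^sub>M ?O) (\<lambda>z. ennreal (?f (?T z)))"
    unfolding G.joint_law_eq_density_output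
  proof (rule density_cong)
    show "AE z in ?p \<Otimes>\<^sub>M ?O. (case z of (v, y) \<Rightarrow> ennreal (noise_density (y - snd v *s c) / output_density ?p c y)) = ennreal (?f (?T z))"
      using ae by eventually_elim (simp add: case_prod_unfold)
  qed (simp_all add: case_prod_unfold)
  have "G.message_output_law c = distr (density (?p \<Otimes>\<^sub>M ?O) (\<lambda>z. ennreal (?f (?T z)))) (borel \<Otimes>\<^sub>M borel) ?T"
    unfolding G.message_output_law_def by (subst J) (simp add: case_prod_unfold)
  also have "\<dots> = density (distr (?p \<Otimes>\<^sub>M ?O) (borel \<Otimes>\<^sub>M borel) ?T) (\<lambda>z. ennreal (?f z))"
    by (rule density_distr[symmetric]) measurable
  also have "\<dots> = density (G.message_law \<Otimes>\<^sub>M ?O) (\<lambda>z. ennreal (?f z))"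
    unfolding G.message_pair_eq by (simp add: case_prod_unfold)
  finally have M: "G.message_output_law c = density (G.message_law \<Otimes>\<^sub>M ?O) (\<lambda>z. ennreal (?f z))" .
  have f: "?f \<in> borel_measurable (G.message_law \<Otimes>\<^sub>M ?O)" by measurable
  have "instantaneous_information borel ?p c = (\<integral>z. log 2 (?f z) \<partial>G.message_output_law c)"
    unfolding G.instantaneous_information_eq
    by (rule KL_divergence_density(2)[OF G.prob_space_message_pair f _ M])
       (intro divide_nonneg_nonneg less_imp_le noise_density_pos G.output_density_pos)
  also have "\<dots> = (\<integral>z. log 2 (?f (?T z)) \<partial>?J)"
    unfolding G.message_output_law_def by (subst integral_distr) (auto simp: case_prod_unfold)
  also have "\<dots> = (\<integral>z. ?L z \<partial>?J)"
  proof (rule integral_cong_AE)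
    show "AE z in ?J. log 2 (?f (?T z)) = ?L z"
      using aeJ by eventually_elim simp
  qed measurable
  also have "\<dots> = log 2 (1 + P * (norm c)\<^sup>2)"
    unfolding G.integral_log_ratio_gaussian(2)[OF P gaussian_input_power(1)[OF P]] gaussian_input_power(2)[OF P]
    by (simp add: log_def)
  finally show ?thesis .
qed

lemma gaussian_input_admissible:
  assumes P: "0 < P"
  shows "gaussian_input P \<in> admissible_inputs borel P"
proof -
  interpret G: input_law "gaussian_input P" borel by (rule input_law_gaussian[OF P])
  have "(\<integral>\<^sup>+(u, x). ennreal ((cmod x)\<^sup>2) \<partial>gaussian_input P) = ennreal P"
    using nn_integral_eq_integral[OF gaussian_input_power(1)[OF P]] gaussian_input_power(2)[OF P]
    by (simp add: case_prod_unfold)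
  then show ?thesis
    using G.prob_space_axioms G.sets_p by (simp add: admissible_inputs_def)
qed

theorem theorem4:
  fixes P\<^sub>T :: real
    and M :: "'w measure"
    and h :: "'w \<Rightarrow> complex ^ 'b"
    and g :: "'w \<Rightarrow> complex ^ 'e"
  assumes "P\<^sub>T > 0"
    and "prob_space M"
    and "h \<in> borel_measurable M"
    and "g \<in> borel_measurable M"
  shows "gaussian_input P\<^sub>T \<in> admissible_inputs borel P\<^sub>T \<and>
    (\<forall>(U :: 'u measure) p. p \<in> admissible_inputs U P\<^sub>T \<longrightarrow>
       EPSR M h g U p \<le> EPSR M h g borel (gaussian_input P\<^sub>T)) \<and>
    EPSR M h g borel (gaussian_input P\<^sub>T) =
      (\<integral>\<^sup>+\<omega>. ennreal (max 0 (log 2 ((1 + P\<^sub>T * (norm (h \<omega>))\<^sup>2) / (1 + P\<^sub>T * (norm (g \<omega>))\<^sup>2)))) \<partial>M)"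
proof (intro conjI allI impI)
  note P = \<open>P\<^sub>T > 0\<close>
  have "log 2 (1 + P\<^sub>T * (norm (h \<omega>))\<^sup>2) - log 2 (1 + P\<^sub>T * (norm (g \<omega>))\<^sup>2) =
      log 2 ((1 + P\<^sub>T * (norm (h \<omega>))\<^sup>2) / (1 + P\<^sub>T * (norm (g \<omega>))\<^sup>2))" for \<omega>
    using P by (intro log_divide_pos[symmetric]) (simp_all add: add_pos_nonneg)
  then show eq: "EPSR M h g borel (gaussian_input P\<^sub>T) =
      (\<integral>\<^sup>+\<omega>. ennreal (max 0 (log 2 ((1 + P\<^sub>T * (norm (h \<omega>))\<^sup>2) / (1 + P\<^sub>T * (norm (g \<omega>))\<^sup>2)))) \<partial>M)"
    unfolding EPSR_def instantaneous_information_gaussian_input[OF P] by simp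
  show "gaussian_input P\<^sub>T \<in> admissible_inputs borel P\<^sub>T" by (rule gaussian_input_admissible[OF P])
  fix U :: "'u measure" and p
  assume p: "p \<in> admissible_inputs U P\<^sub>T"
  then interpret p: input_law p U
    by (intro input_law.intro input_law_axioms.intro) (auto simp: admissible_inputs_def)
  have le: "(\<integral>\<^sup>+v. ennreal ((cmod (snd v))\<^sup>2) \<partial>p) \<le> ennreal P\<^sub>T"
    using p by (auto simp: admissible_inputs_def case_prod_unfold)
  have power: "integrable p (\<lambda>v. (cmod (snd v))\<^sup>2)"
    by (rule integrableI_bounded) (auto intro: order.strict_trans1[OF le])
  have power_le: "(\<integral>v. (cmod (snd v))\<^sup>2 \<partial>p) \<le> P\<^sub>T"
    using le P by (subst (asm) nn_integral_eq_integral[OF power]) auto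
  show "EPSR M h g U p \<le> EPSR M h g borel (gaussian_input P\<^sub>T)"
    unfolding eq unfolding EPSR_def
  proof (intro nn_integral_mono ennreal_leI)
    fix \<omega>
    show "max 0 (instantaneous_information U p (h \<omega>) - instantaneous_information U p (g \<omega>))
      \<le> max 0 (log 2 ((1 + P\<^sub>T * (norm (h \<omega>))\<^sup>2) / (1 + P\<^sub>T * (norm (g \<omega>))\<^sup>2)))"
    \<comment> \<open>If the eavesdropper has the stronger channel, data processing with exchanged
      roles makes the difference nonpositive, and its positive part is \<open>0\<close>.\<close>
    proof (cases "norm (g \<omega>) \<le> norm (h \<omega>)")
      case True
      then show ?thesis
        using p.instantaneous_information_diff_le(2)[OF True P power power_le] by simp
    next
      case False
      then show ?thesis
        using p.instantaneous_information_diff_le(1)[of "h \<omega>" "g \<omega>", OF _ P power power_le] by simp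
    qed
  qed
qed

end
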